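(* Let $C$ be the path category of a triple $(\mathbb{X},\Gamma/{\sim})$, and suppose $C$ is also a site with coverage $\mathrm{Cov}(C)$. Let $\mathfrak{P}$ be a screen of $(\mathbb{X},\Gamma/{\sim})$ and give $\overline{Q(C,\mathfrak{P})}$ the coverage $\mathrm{Cov}(\overline{Q(C,\mathfrak{P})})$ consisting of the sets $\{Hp(f_i):Hp(x_i)\to Hp(x)\}_{i\in I}$ for each covering $\{f_i:x_i\to x\}_{i\in I}$ in $\mathrm{Cov}(C)$ (including empty coverings). Then any sheaf on $\overline{Q(C,\mathfrak{P})}$ lifts to a sheaf on $C$ (by precomposition with $Hp:C\to\overline{Q(C,\mathfrak{P})}$).
   Context: TRIPLES. A path in a nonempty set $\mathbb{X}$ is any function $\gamma:[0,1]\to\mathbb{X}$; $\mathrm{im}(\gamma)$ is its image. If $\gamma(1)=\gamma'(0)$, then $\gamma\cdot\gamma'$ is the path equal to $\gamma(2t)$ for $0\le t\le\frac12$ and to $\gamma'(2t-1)$ for $\frac12\le t\le1$. A triple $(\mathbb{X},\Gamma/{\sim})$ consists of a nonempty set $\mathbb{X}$, a set $\Gamma$ of paths in $\mathbb{X}$, and an equivalence relation $\sim$ on $\Gamma$ (equivalent paths have the same endpoints) such that: (a) $\gamma,\gamma'\in\Gamma$ with $\gamma(1)=\gamma'(0)$ implies $\gamma\cdot\gamma'\in\Gamma$; (b) if $\gamma\in\Gamma$ and $\phi:[0,1]\to[0,1]$ is weakly order preserving and sends intervals to intervals, then $\gamma\circ\phi\in\Gamma$; (c) all constant paths are in $\Gamma$;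 (d) a path equivalent to a constant path is constant; (e) if in (b) also $\phi(0)=0$, $\phi(1)=1$, then $\gamma\sim\gamma\circ\phi$; (f) if $\gamma,\gamma',\rho,\rho'\in\Gamma$ and $\rho\cdot\gamma\cdot\rho'$, $\rho\cdot\gamma'\cdot\rho'$ are defined and in $\Gamma$, then $\gamma\sim\gamma'$ if and only if $\rho\cdot\gamma\cdot\rho'\sim\rho\cdot\gamma'\cdot\rho'$. The class of $\gamma$ is $[\gamma]$. SCREENS. A screen of $(\mathbb{X},\Gamma/{\sim})$ is a partition $\mathfrak{P}$ of $\mathbb{X}$, whose elements are called pixels, such that: (S1) if $\gamma,\gamma'\in\Gamma$ have the same start and the same end and $\mathrm{im}(\gamma)\subset\mathsf{X}\in\mathfrak{P}$, then $\gamma\sim\gamma'$ if and only if $\mathrm{im}(\gamma')\subset\mathsf{X}$; (S2) any two points $x,y$ of a pixel $\mathsf{X}$ are joined by a finite walk $\gamma_0\cdot\gamma_1^{-1}\cdot\gamma_2\cdots\gamma_{2n-1}^{-1}\cdot\gamma_{2n}$ from $x$ to $y$ (where $\gamma^{-1}$ is $\gamma$ run backwards) with all $\gamma_i\in\Gamma$ and $\mathrm{im}(\gamma_i)\subset\mathsf{X}$; (S3) if $\rho,\gamma\in\Gamma$, $\rho(0)=\gamma(0)$ and $\mathrm{im}(\rho)$ lies in a pixel, then there are $\rho',\gamma'\in\Gamma$ with $\mathrm{im}(\rho')$ in a pixel and $\gamma\cdot\rho'\sim\rho\cdot\gamma'$; dually, if $\rho',\gamma'\in\Gamma$, $\rho'(1)=\gamma'(1)$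 and $\mathrm{im}(\rho')$ lies in a pixel, then there are $\rho,\gamma\in\Gamma$ with $\mathrm{im}(\rho)$ in a pixel and $\gamma\cdot\rho'\sim\rho\cdot\gamma'$; (S4) for every $\gamma\in\Gamma$ there are a finite partition $\{I_i\}_{i=1}^n$ of $[0,1]$ into subintervals (listed in increasing order) and pixels $(\mathsf{X}_1,\dots,\mathsf{X}_n)$ with $\gamma(I_i)\subset\mathsf{X}_i$, where for $i\ne j$ the equality $\mathsf{X}_i=\mathsf{X}_j$ is allowed only if $|i-j|>1$; (S5) if $\gamma,\gamma'\in\Gamma$ have the same start and the same end and admit the same partition $\{I_i\}$ and the same list of pixels as in (S4), then $\gamma\sim\gamma'$. PATH CATEGORY AND PIXELATION. $C$ has objects the points of $\mathbb{X}$, $\mathrm{Hom}_C(x,y)=\{[\gamma]\mid\gamma\in\Gamma,\gamma(0)=x,\gamma(1)=y\}$, composition $[\gamma']\circ[\gamma]=[\gamma\cdot\gamma']$. $\Sigma_{\mathfrak{P}}$ is the class of $[\rho]$ with $\mathrm{im}(\rho)$ in a pixel of $\mathfrak{P}$ (it admits a two-sided calculus of fractions), and $p:C\to C[\Sigma_{\mathfrak{P}}^{-1}]$ is the localization. Choose $s_{\mathsf{X}}\in\mathsf{X}$ in each pixel. A pseudo arrow is a morphism $[\rho]^{-1}[\gamma]$ of $C[\Sigma_{\mathfrak{P}}^{-1}]$ with $[\rho]\in\Sigma_{\mathfrak{P}}$ such that $\gamma$ has a partition as in (S4) with exactly two elements. $Q(C,\mathfrak{P})$ is the quiver with vertex set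 $\mathfrak{P}$ and arrows $\mathsf{X}\to\mathsf{Y}$ the pseudo arrows $s_{\mathsf{X}}\to s_{\mathsf{Y}}$ (at most one). $\Psi$ is the functor from the free category on it to $C[\Sigma_{\mathfrak{P}}^{-1}]$, $\mathsf{X}\mapsto s_{\mathsf{X}}$, sending arrows to their pseudo arrows; $\overline{Q(C,\mathfrak{P})}$ is the quotient of the free category identifying parallel $f,g$ with $\Psi(f)=\Psi(g)$. $H:C[\Sigma_{\mathfrak{P}}^{-1}]\to\overline{Q(C,\mathfrak{P})}$ is the equivalence sending $x\in\mathsf{X}$ to $\mathsf{X}$, morphisms $[\rho]^{-1}[\rho']$ with $[\rho],[\rho']\in\Sigma_{\mathfrak{P}}$ to identities, and pseudo arrows $x\to y$ ($x\in\mathsf{X}$, $y\in\mathsf{Y}$) to the arrow $\mathsf{X}\to\mathsf{Y}$. SITES. A covering is a set $\{f_i:x_i\to x\}_{i\in I}$ of morphisms with common target (the empty set with chosen target $x$ is allowed); a coverage is a set of coverings. A small category $C$ with a coverage $\mathrm{Cov}(C)$ is a site if: (1) $\{f\}\in\mathrm{Cov}(C)$ for every isomorphism $f$; (2) if $\{f_i:x_i\to x\}_{i\in I}\in\mathrm{Cov}(C)$ and $\{g_{ij}:y_{ij}\to x_i\}_{j\in J_i}\in\mathrm{Cov}(C)$ for each $i$, then $\{f_ig_{ij}\}_{i,j}\in\mathrm{Cov}(C)$; (3) if $\{f_i:x_i\to x\}_{i\in I}\in\mathrm{Cov}(C)$ and $g:y\to x$ is a morphism, then all pullbacks $x_i\times_xy$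 exist and $\{x_i\times_xy\to y\}_{i\in I}\in\mathrm{Cov}(C)$. A sheaf is a contravariant functor $F$ such that for each covering $\{x_i\to x\}$ the diagram $F(x)\to\prod_iF(x_i)\rightrightarrows\prod_{i,j}F(x_i\times_xx_j)$ is an equalizer. *)

theory Defs
  imports "HOL-Analysis.Analysis" "HOL-Library.Disjoint_Sets"
begin

section \<open>Categories\<close>

text \<open>\<open>Cmp C g f\<close> is the composite of \<open>f\<close> followed by \<open>g\<close>.\<close>

record ('o, 'm) cat =
  Obj :: "'o set"
  Mor :: "'m set"
  Dom :: "'m \<Rightarrow> 'o"
  Cod :: "'m \<Rightarrow> 'o"
  Ide :: "'o \<Rightarrow> 'm"
  Cmp :: "'m \<Rightarrow> 'm \<Rightarrow> 'm"

definition is_category :: "('o, 'm) cat \<Rightarrow> bool" where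
  "is_category C \<longleftrightarrow>
     (\<forall>f\<in>Mor C. Dom C f \<in> Obj C \<and> Cod C f \<in> Obj C) \<and>
     (\<forall>x\<in>Obj C. Ide C x \<in> Mor C \<and> Dom C (Ide C x) = x \<and> Cod C (Ide C x) = x) \<and>
     (\<forall>f\<in>Mor C. \<forall>g\<in>Mor C. Cod C f = Dom C g \<longrightarrow>
        Cmp C g f \<in> Mor C \<and> Dom C (Cmp C g f) = Dom C f \<and> Cod C (Cmp C g f) = Cod C g) \<and>
     (\<forall>f\<in>Mor C. Cmp C f (Ide C (Dom C f)) = f \<and> Cmp C (Ide C (Cod C f)) f = f) \<and>
     (\<forall>f\<in>Mor C. \<forall>g\<in>Mor C. \<forall>h\<in>Mor C. Cod C f = Dom C g \<and> Cod C g = Dom C h \<longrightarrow>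
        Cmp C h (Cmp C g f) = Cmp C (Cmp C h g) f)"

definition is_iso :: "('o, 'm) cat \<Rightarrow> 'm \<Rightarrow> bool" where
  "is_iso C f \<longleftrightarrow> f \<in> Mor C \<and>
     (\<exists>g\<in>Mor C. Dom C g = Cod C f \<and> Cod C g = Dom C f \<and>
        Cmp C g f = Ide C (Dom C f) \<and> Cmp C f g = Ide C (Cod C f))"

text \<open>\<open>is_pullback C f g p q\<close>: the object \<open>Dom C p\<close>, with projections \<open>p\<close> to the domain of \<open>f\<close> and
  \<open>q\<close> to the domain of \<open>g\<close>, is a pullback of \<open>f\<close> and \<open>g\<close>.\<close>

definition is_pullback :: "('o, 'm) cat \<Rightarrow> 'm \<Rightarrow> 'm \<Rightarrow> 'm \<Rightarrow> 'm \<Rightarrow> bool" where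
  "is_pullback C f g p q \<longleftrightarrow>
     f \<in> Mor C \<and> g \<in> Mor C \<and> Cod C f = Cod C g \<and>
     p \<in> Mor C \<and> q \<in> Mor C \<and> Dom C p = Dom C q \<and> Cod C p = Dom C f \<and> Cod C q = Dom C g \<and>
     Cmp C f p = Cmp C g q \<and>
     (\<forall>p'\<in>Mor C. \<forall>q'\<in>Mor C.
        Dom C p' = Dom C q' \<and> Cod C p' = Dom C f \<and> Cod C q' = Dom C g \<and>
        Cmp C f p' = Cmp C g q' \<longrightarrow>
        (\<exists>!h. h \<in> Mor C \<and> Dom C h = Dom C p' \<and> Cod C h = Dom C p \<and>
              Cmp C p h = p' \<and> Cmp C q h = q'))"

record ('o, 'm, 'p, 'n) fun_data =
  Fob :: "'o \<Rightarrow> 'p"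
  Fmo :: "'m \<Rightarrow> 'n"

definition is_functor :: "('o, 'm) cat \<Rightarrow> ('p, 'n) cat \<Rightarrow> ('o, 'm, 'p, 'n) fun_data \<Rightarrow> bool" where
  "is_functor C D F \<longleftrightarrow>
     (\<forall>x\<in>Obj C. Fob F x \<in> Obj D \<and> Fmo F (Ide C x) = Ide D (Fob F x)) \<and>
     (\<forall>f\<in>Mor C. Fmo F f \<in> Mor D \<and> Dom D (Fmo F f) = Fob F (Dom C f) \<and>
        Cod D (Fmo F f) = Fob F (Cod C f)) \<and>
     (\<forall>f\<in>Mor C. \<forall>g\<in>Mor C. Cod C f = Dom C g \<longrightarrow>
        Fmo F (Cmp C g f) = Cmp D (Fmo F g) (Fmo F f))"

definition id_functor :: "('o, 'm, 'o, 'm) fun_data" where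
  "id_functor = \<lparr>Fob = (\<lambda>x. x), Fmo = (\<lambda>f. f)\<rparr>"

definition comp_functor ::
    "('p, 'n, 'q, 'k) fun_data \<Rightarrow> ('o, 'm, 'p, 'n) fun_data \<Rightarrow> ('o, 'm, 'q, 'k) fun_data" where
  "comp_functor G F = \<lparr>Fob = Fob G \<circ> Fob F, Fmo = Fmo G \<circ> Fmo F\<rparr>"

definition is_natural_iso ::
    "('o, 'm) cat \<Rightarrow> ('p, 'n) cat \<Rightarrow> ('o, 'm, 'p, 'n) fun_data \<Rightarrow> ('o, 'm, 'p, 'n) fun_data \<Rightarrow>
     ('o \<Rightarrow> 'n) \<Rightarrow> bool" where
  "is_natural_iso C D F G \<eta> \<longleftrightarrow>
     (\<forall>x\<in>Obj C. is_iso D (\<eta> x) \<and> Dom D (\<eta> x) = Fob F x \<and> Cod D (\<eta> x) = Fob G x) \<and>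
     (\<forall>f\<in>Mor C. Cmp D (\<eta> (Cod C f)) (Fmo F f) = Cmp D (Fmo G f) (\<eta> (Dom C f)))"

definition is_equivalence :: "('o, 'm) cat \<Rightarrow> ('p, 'n) cat \<Rightarrow> ('o, 'm, 'p, 'n) fun_data \<Rightarrow> bool" where
  "is_equivalence C D F \<longleftrightarrow> is_functor C D F \<and>
     (\<exists>G \<eta> \<epsilon>. is_functor D C G \<and>
        is_natural_iso C C id_functor (comp_functor G F) \<eta> \<and>
        is_natural_iso D D (comp_functor F G) id_functor \<epsilon>)"

text \<open>The quotient of \<open>C\<close> by an equivalence relation \<open>r\<close> on its morphisms that relates only parallel
  morphisms and is compatible with composition. The category axioms need only hold in \<open>C\<close> up to
  \<open>r\<close>; in particular, composition of paths in a triple is associative only up to equivalence.\<close>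

definition quot_cat :: "('o, 'm) cat \<Rightarrow> ('m \<times> 'm) set \<Rightarrow> ('o, 'm set) cat" where
  "quot_cat C r = \<lparr>
     Obj = Obj C,
     Mor = Mor C // r,
     Dom = (\<lambda>A. the_elem (Dom C ` A)),
     Cod = (\<lambda>A. the_elem (Cod C ` A)),
     Ide = (\<lambda>x. r `` {Ide C x}),
     Cmp = (\<lambda>B A. \<Union>g\<in>B. \<Union>f\<in>A. r `` {Cmp C g f})\<rparr>"

inductive_set cong_closure :: "('o, 'm) cat \<Rightarrow> ('m \<times> 'm) set \<Rightarrow> ('m \<times> 'm) set"
  for C :: "('o, 'm) cat" and R :: "('m \<times> 'm) set" where
  base: "(f, g) \<in> R \<Longrightarrow> (f, g) \<in> cong_closure C R"
| refl: "f \<in> Mor C \<Longrightarrow> (f, f) \<in> cong_closure C R"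
| sym: "(f, g) \<in> cong_closure C R \<Longrightarrow> (g, f) \<in> cong_closure C R"
| trans: "(f, g) \<in> cong_closure C R \<Longrightarrow> (g, h) \<in> cong_closure C R \<Longrightarrow> (f, h) \<in> cong_closure C R"
| comp: "(f, f') \<in> cong_closure C R \<Longrightarrow> (g, g') \<in> cong_closure C R \<Longrightarrow> Cod C f = Dom C g \<Longrightarrow>
    (Cmp C g f, Cmp C g' f') \<in> cong_closure C R"

section \<open>Free categories on quivers\<close>

record ('v, 'a) quiver =
  Vert :: "'v set"
  Arr :: "'a set"
  Src :: "'a \<Rightarrow> 'v"
  Tgt :: "'a \<Rightarrow> 'v"

inductive quiver_walk :: "('v, 'a) quiver \<Rightarrow> 'v \<Rightarrow> 'a list \<Rightarrow> 'v \<Rightarrow> bool"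
  for Q :: "('v, 'a) quiver" where
  Nil: "x \<in> Vert Q \<Longrightarrow> quiver_walk Q x [] x"
| Cons: "a \<in> Arr Q \<Longrightarrow> Src Q a \<in> Vert Q \<Longrightarrow> quiver_walk Q (Tgt Q a) w y \<Longrightarrow>
    quiver_walk Q (Src Q a) (a # w) y"

text \<open>A morphism is a triple (source, arrows in the order in which they are traversed, target).\<close>

definition free_cat :: "('v, 'a) quiver \<Rightarrow> ('v, 'v \<times> 'a list \<times> 'v) cat" where
  "free_cat Q = \<lparr>
     Obj = Vert Q,
     Mor = {(x, w, y). quiver_walk Q x w y},
     Dom = (\<lambda>f. fst f),
     Cod = (\<lambda>f. snd (snd f)),
     Ide = (\<lambda>x. (x, [], x)),
     Cmp = (\<lambda>g f. (fst f, fst (snd f) @ fst (snd g), snd (snd g)))\<rparr>"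

definition free_arrow :: "('v, 'a) quiver \<Rightarrow> 'a \<Rightarrow> 'v \<times> 'a list \<times> 'v" where
  "free_arrow Q a = (Src Q a, [a], Tgt Q a)"

primrec walk_value ::
    "('v, 'a) quiver \<Rightarrow> ('p, 'n) cat \<Rightarrow> ('v \<Rightarrow> 'p) \<Rightarrow> ('a \<Rightarrow> 'n) \<Rightarrow> 'v \<Rightarrow> 'a list \<Rightarrow> 'n" where
  "walk_value Q D v m x [] = Ide D (v x)"
| "walk_value Q D v m x (a # w) = Cmp D (walk_value Q D v m (Tgt Q a) w) (m a)"

text \<open>The functor from the free category to \<open>D\<close> induced by maps \<open>v\<close> on vertices and \<open>m\<close> on arrows.\<close>

definition free_functor ::
    "('v, 'a) quiver \<Rightarrow> ('p, 'n) cat \<Rightarrow> ('v \<Rightarrow> 'p) \<Rightarrow> ('a \<Rightarrow> 'n) \<Rightarrow>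
     ('v, 'v \<times> 'a list \<times> 'v, 'p, 'n) fun_data" where
  "free_functor Q D v m =
     \<lparr>Fob = v, Fmo = (\<lambda>f. walk_value Q D v m (fst f) (fst (snd f)))\<rparr>"

definition functor_kernel :: "('o, 'm) cat \<Rightarrow> ('o, 'm, 'p, 'n) fun_data \<Rightarrow> ('m \<times> 'm) set" where
  "functor_kernel C F = {(f, g). f \<in> Mor C \<and> g \<in> Mor C \<and>
     Dom C f = Dom C g \<and> Cod C f = Cod C g \<and> Fmo F f = Fmo F g}"

section \<open>Localization\<close>

text \<open>The localization of \<open>C\<close> at a set \<open>S\<close> of morphisms, by generators and relations: zigzags of
  morphisms of \<open>C\<close> and formal inverses of elements of \<open>S\<close>, modulo the congruence generated by the
  identities and compositions of \<open>C\<close> and by the relations making \<open>Bwd s\<close> inverse to \<open>Fwd s\<close>.\<close>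

datatype 'm zig = Fwd 'm | Bwd 'm

definition zigzag_quiver :: "('o, 'm) cat \<Rightarrow> 'm set \<Rightarrow> ('o, 'm zig) quiver" where
  "zigzag_quiver C S = \<lparr>
     Vert = Obj C,
     Arr = Fwd ` Mor C \<union> Bwd ` S,
     Src = (\<lambda>a. case a of Fwd f \<Rightarrow> Dom C f | Bwd s \<Rightarrow> Cod C s),
     Tgt = (\<lambda>a. case a of Fwd f \<Rightarrow> Cod C f | Bwd s \<Rightarrow> Dom C s)\<rparr>"

definition loc_relations ::
    "('o, 'm) cat \<Rightarrow> 'm set \<Rightarrow> (('o \<times> 'm zig list \<times> 'o) \<times> ('o \<times> 'm zig list \<times> 'o)) set" where
  "loc_relations C S =
     {((x, [Fwd (Ide C x)], x), (x, [], x)) |x. x \<in> Obj C} \<union>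
     {((Dom C f, [Fwd f, Fwd g], Cod C g), (Dom C f, [Fwd (Cmp C g f)], Cod C g)) |f g.
        f \<in> Mor C \<and> g \<in> Mor C \<and> Cod C f = Dom C g} \<union>
     {((Dom C s, [Fwd s, Bwd s], Dom C s), (Dom C s, [], Dom C s)) |s. s \<in> S} \<union>
     {((Cod C s, [Bwd s, Fwd s], Cod C s), (Cod C s, [], Cod C s)) |s. s \<in> S}"

definition loc_cong ::
    "('o, 'm) cat \<Rightarrow> 'm set \<Rightarrow> (('o \<times> 'm zig list \<times> 'o) \<times> ('o \<times> 'm zig list \<times> 'o)) set" where
  "loc_cong C S = cong_closure (free_cat (zigzag_quiver C S)) (loc_relations C S)"

definition localization ::
    "('o, 'm) cat \<Rightarrow> 'm set \<Rightarrow> ('o, ('o \<times> 'm zig list \<times> 'o) set) cat" where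
  "localization C S = quot_cat (free_cat (zigzag_quiver C S)) (loc_cong C S)"

definition loc_functor ::
    "('o, 'm) cat \<Rightarrow> 'm set \<Rightarrow> ('o, 'm, 'o, ('o \<times> 'm zig list \<times> 'o) set) fun_data" where
  "loc_functor C S = \<lparr>Fob = (\<lambda>x. x),
     Fmo = (\<lambda>f. loc_cong C S `` {free_arrow (zigzag_quiver C S) (Fwd f)})\<rparr>"

definition loc_inverse ::
    "('o, 'm) cat \<Rightarrow> 'm set \<Rightarrow> 'm \<Rightarrow> ('o \<times> 'm zig list \<times> 'o) set" where
  "loc_inverse C S s = loc_cong C S `` {free_arrow (zigzag_quiver C S) (Bwd s)}"

section \<open>Sites and sheaves\<close>

text \<open>A covering is a pair of its target and a set of morphisms with that target, so that an empty
  covering has a target too. A coverage is a set of coverings.\<close>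

definition is_coverage :: "('o, 'm) cat \<Rightarrow> ('o \<times> 'm set) set \<Rightarrow> bool" where
  "is_coverage C Cov \<longleftrightarrow>
     (\<forall>(x, U)\<in>Cov. x \<in> Obj C \<and> U \<subseteq> Mor C \<and> (\<forall>f\<in>U. Cod C f = x))"

definition is_site :: "('o, 'm) cat \<Rightarrow> ('o \<times> 'm set) set \<Rightarrow> bool" where
  "is_site C Cov \<longleftrightarrow> is_category C \<and> is_coverage C Cov \<and>
     (\<forall>f. is_iso C f \<longrightarrow> (Cod C f, {f}) \<in> Cov) \<and>
     (\<forall>x U V. (x, U) \<in> Cov \<and> (\<forall>f\<in>U. (Dom C f, V f) \<in> Cov) \<longrightarrow>
        (x, {Cmp C f g |f g. f \<in> U \<and> g \<in> V f}) \<in> Cov) \<and>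
     (\<forall>x U g. (x, U) \<in> Cov \<and> g \<in> Mor C \<and> Cod C g = x \<longrightarrow>
        (\<exists>p q. (\<forall>f\<in>U. is_pullback C f g (p f) (q f)) \<and> (Dom C g, q ` U) \<in> Cov))"

definition image_coverage ::
    "('o, 'm, 'p, 'n) fun_data \<Rightarrow> ('o \<times> 'm set) set \<Rightarrow> ('p \<times> 'n set) set" where
  "image_coverage F Cov = {(Fob F x, Fmo F ` U) |x U. (x, U) \<in> Cov}"

text \<open>Contravariant set-valued functors; \<open>Res F f\<close> maps \<open>Sec F (Cod C f)\<close> to \<open>Sec F (Dom C f)\<close>.\<close>

record ('o, 'm, 's) presheaf =
  Sec :: "'o \<Rightarrow> 's set"
  Res :: "'m \<Rightarrow> 's \<Rightarrow> 's"

definition is_presheaf :: "('o, 'm) cat \<Rightarrow> ('o, 'm, 's) presheaf \<Rightarrow> bool" where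
  "is_presheaf C F \<longleftrightarrow>
     (\<forall>f\<in>Mor C. Res F f \<in> Sec F (Cod C f) \<rightarrow> Sec F (Dom C f)) \<and>
     (\<forall>x\<in>Obj C. \<forall>a\<in>Sec F x. Res F (Ide C x) a = a) \<and>
     (\<forall>f\<in>Mor C. \<forall>g\<in>Mor C. Cod C f = Dom C g \<longrightarrow>
        (\<forall>a\<in>Sec F (Cod C g). Res F (Cmp C g f) a = Res F f (Res F g a)))"

definition precompose ::
    "('p, 'n, 's) presheaf \<Rightarrow> ('o, 'm, 'p, 'n) fun_data \<Rightarrow> ('o, 'm, 's) presheaf" where
  "precompose F G = \<lparr>Sec = Sec F \<circ> Fob G, Res = Res F \<circ> Fmo G\<rparr>"

text \<open>\<open>A \<rightarrow> B \<rightrightarrows> D\<close>, with maps \<open>e\<close> and \<open>u, v\<close>, is an equalizer of sets.\<close>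

definition is_set_equalizer ::
    "'a set \<Rightarrow> 'b set \<Rightarrow> 'd set \<Rightarrow> ('a \<Rightarrow> 'b) \<Rightarrow> ('b \<Rightarrow> 'd) \<Rightarrow> ('b \<Rightarrow> 'd) \<Rightarrow> bool" where
  "is_set_equalizer A B D e u v \<longleftrightarrow>
     e \<in> A \<rightarrow> B \<and> u \<in> B \<rightarrow> D \<and> v \<in> B \<rightarrow> D \<and> bij_betw e A {b \<in> B. u b = v b}"

text \<open>The diagram of a sheaf condition involves pullbacks: they are required to exist, and the
  diagram is required to be an equalizer for every choice \<open>p f g\<close>, \<open>q f g\<close> of them.\<close>

definition is_sheaf ::
    "('o, 'm) cat \<Rightarrow> ('o \<times> 'm set) set \<Rightarrow> ('o, 'm, 's) presheaf \<Rightarrow> bool" where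
  "is_sheaf C Cov F \<longleftrightarrow> is_presheaf C F \<and>
     (\<forall>(x, U)\<in>Cov.
        (\<forall>f\<in>U. \<forall>g\<in>U. \<exists>p q. is_pullback C f g p q) \<and>
        (\<forall>p q. (\<forall>f\<in>U. \<forall>g\<in>U. is_pullback C f g (p f g) (q f g)) \<longrightarrow>
           is_set_equalizer
             (Sec F x)
             (\<Pi>\<^sub>E f\<in>U. Sec F (Dom C f))
             (\<Pi>\<^sub>E (f, g)\<in>U \<times> U. Sec F (Dom C (p f g)))
             (\<lambda>a. \<lambda>f\<in>U. Res F f a)
             (\<lambda>b. \<lambda>(f, g)\<in>U \<times> U. Res F (p f g) (b f))
             (\<lambda>b. \<lambda>(f, g)\<in>U \<times> U. Res F (q f g) (b g))))"

section \<open>Triples\<close>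

text \<open>A path is an extensional function on \<open>{0..1}\<close>, so that equality of paths is HOL equality.\<close>

type_synonym 'x path = "real \<Rightarrow> 'x"

definition path_im :: "'x path \<Rightarrow> 'x set" where
  "path_im \<gamma> = \<gamma> ` {0..1}"

definition path_const :: "'x \<Rightarrow> 'x path" where
  "path_const x = (\<lambda>t\<in>{0..1}. x)"

definition path_concat :: "'x path \<Rightarrow> 'x path \<Rightarrow> 'x path" where
  "path_concat \<gamma> \<gamma>' = (\<lambda>t\<in>{0..1}. if t \<le> 1/2 then \<gamma> (2 * t) else \<gamma>' (2 * t - 1))"

definition path_reparam :: "(real \<Rightarrow> real) \<Rightarrow> bool" where
  "path_reparam \<phi> \<longleftrightarrow> \<phi> \<in> {0..1} \<rightarrow> {0..1} \<and> mono_on {0..1} \<phi> \<and>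
     (\<forall>J \<subseteq> {0..1}. is_interval J \<longrightarrow> is_interval (\<phi> ` J))"

record 'x triple =
  Pts :: "'x set"
  Paths :: "'x path set"
  Eqv :: "('x path \<times> 'x path) set"

locale path_triple =
  fixes T :: "'x triple"
  assumes Pts_nonempty: "Pts T \<noteq> {}"
    and Paths_subset: "Paths T \<subseteq> {0..1} \<rightarrow>\<^sub>E Pts T"
    and equiv_Eqv: "equiv (Paths T) (Eqv T)"
    and Eqv_endpoints: "(\<gamma>, \<gamma>') \<in> Eqv T \<Longrightarrow> \<gamma> 0 = \<gamma>' 0 \<and> \<gamma> 1 = \<gamma>' 1"
    and concat_closed:
      "\<lbrakk>\<gamma> \<in> Paths T; \<gamma>' \<in> Paths T; \<gamma> 1 = \<gamma>' 0\<rbrakk> \<Longrightarrow> path_concat \<gamma> \<gamma>' \<in> Paths T"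
    and reparam_closed:
      "\<lbrakk>\<gamma> \<in> Paths T; path_reparam \<phi>\<rbrakk> \<Longrightarrow> compose {0..1} \<gamma> \<phi> \<in> Paths T"
    and const_closed: "x \<in> Pts T \<Longrightarrow> path_const x \<in> Paths T"
    and Eqv_const: "(\<gamma>, path_const x) \<in> Eqv T \<Longrightarrow> \<exists>y. \<gamma> = path_const y"
    and Eqv_reparam:
      "\<lbrakk>\<gamma> \<in> Paths T; path_reparam \<phi>; \<phi> 0 = 0; \<phi> 1 = 1\<rbrakk> \<Longrightarrow> (\<gamma>, compose {0..1} \<gamma> \<phi>) \<in> Eqv T"
    and Eqv_concat:
      "\<lbrakk>\<gamma> \<in> Paths T; \<gamma>' \<in> Paths T; \<rho> \<in> Paths T; \<rho>' \<in> Paths T;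
        \<rho> 1 = \<gamma> 0; \<gamma> 1 = \<rho>' 0; \<rho> 1 = \<gamma>' 0; \<gamma>' 1 = \<rho>' 0;
        path_concat (path_concat \<rho> \<gamma>) \<rho>' \<in> Paths T;
        path_concat (path_concat \<rho> \<gamma>') \<rho>' \<in> Paths T\<rbrakk> \<Longrightarrow>
        (\<gamma>, \<gamma>') \<in> Eqv T \<longleftrightarrow>
        (path_concat (path_concat \<rho> \<gamma>) \<rho>', path_concat (path_concat \<rho> \<gamma>') \<rho>') \<in> Eqv T"

definition path_class :: "'x triple \<Rightarrow> 'x path \<Rightarrow> 'x path set" where
  "path_class T \<gamma> = Eqv T `` {\<gamma>}"

definition path_precat :: "'x triple \<Rightarrow> ('x, 'x path) cat" where
  "path_precat T = \<lparr>Obj = Pts T, Mor = Paths T, Dom = (\<lambda>\<gamma>. \<gamma> 0), Cod = (\<lambda>\<gamma>. \<gamma> 1),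
     Ide = path_const, Cmp = (\<lambda>\<gamma>' \<gamma>. path_concat \<gamma> \<gamma>')\<rparr>"

definition path_cat :: "'x triple \<Rightarrow> ('x, 'x path set) cat" where
  "path_cat T = quot_cat (path_precat T) (Eqv T)"

section \<open>Screens\<close>

definition in_pixel :: "'x set set \<Rightarrow> 'x path \<Rightarrow> bool" where
  "in_pixel P \<gamma> \<longleftrightarrow> (\<exists>X\<in>P. path_im \<gamma> \<subseteq> X)"

text \<open>A partition of \<open>{0..1}\<close> into (nonempty, possibly degenerate) subintervals listed in increasing
  order, with the pixels that contain their images; consecutive pixels are distinct.\<close>

definition pixel_partition :: "'x set set \<Rightarrow> 'x path \<Rightarrow> real set list \<Rightarrow> 'x set list \<Rightarrow> bool" where
  "pixel_partition P \<gamma> Is Xs \<longleftrightarrow>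
     length Is = length Xs \<and>
     \<Union>(set Is) = {0..1} \<and>
     (\<forall>I\<in>set Is. I \<noteq> {} \<and> is_interval I) \<and>
     (\<forall>i j. i < j \<and> j < length Is \<longrightarrow> (\<forall>s\<in>Is ! i. \<forall>t\<in>Is ! j. s < t)) \<and>
     set Xs \<subseteq> P \<and>
     (\<forall>i<length Is. \<gamma> ` (Is ! i) \<subseteq> Xs ! i) \<and>
     (\<forall>i. Suc i < length Xs \<longrightarrow> Xs ! i \<noteq> Xs ! Suc i)"

text \<open>In \<open>pixel_connected\<close>, \<open>z i\<close> and \<open>z (Suc i)\<close> are the ends of the \<open>i\<close>-th path of the walk, which
  is traversed backwards if \<open>i\<close> is odd.\<close>

locale screen = path_triple T for T :: "'x triple" +
  fixes P :: "'x set set"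
  assumes partition: "partition_on (Pts T) P"
    and pixel_Eqv:
      "\<lbrakk>\<gamma> \<in> Paths T; \<gamma>' \<in> Paths T; \<gamma> 0 = \<gamma>' 0; \<gamma> 1 = \<gamma>' 1; X \<in> P; path_im \<gamma> \<subseteq> X\<rbrakk> \<Longrightarrow>
        (\<gamma>, \<gamma>') \<in> Eqv T \<longleftrightarrow> path_im \<gamma>' \<subseteq> X"
    and pixel_connected:
      "\<lbrakk>X \<in> P; x \<in> X; y \<in> X\<rbrakk> \<Longrightarrow>
        \<exists>(n::nat) \<gamma> z. z 0 = x \<and> z (2 * n + 1) = y \<and>
          (\<forall>i\<le>2 * n. \<gamma> i \<in> Paths T \<and> path_im (\<gamma> i) \<subseteq> X \<and>
             (if even i then \<gamma> i 0 = z i \<and> \<gamma> i 1 = z (Suc i)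
              else \<gamma> i 0 = z (Suc i) \<and> \<gamma> i 1 = z i))"
    and pixel_span:
      "\<lbrakk>\<rho> \<in> Paths T; \<gamma> \<in> Paths T; \<rho> 0 = \<gamma> 0; in_pixel P \<rho>\<rbrakk> \<Longrightarrow>
        \<exists>\<rho>'\<in>Paths T. \<exists>\<gamma>'\<in>Paths T. in_pixel P \<rho>' \<and> \<gamma> 1 = \<rho>' 0 \<and> \<rho> 1 = \<gamma>' 0 \<and>
          (path_concat \<gamma> \<rho>', path_concat \<rho> \<gamma>') \<in> Eqv T"
    and pixel_cospan:
      "\<lbrakk>\<rho>' \<in> Paths T; \<gamma>' \<in> Paths T; \<rho>' 1 = \<gamma>' 1; in_pixel P \<rho>'\<rbrakk> \<Longrightarrow>
        \<exists>\<rho>\<in>Paths T. \<exists>\<gamma>\<in>Paths T. in_pixel P \<rho> \<and> \<gamma> 1 = \<rho>' 0 \<and> \<rho> 1 = \<gamma>' 0 \<and>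
          (path_concat \<gamma> \<rho>', path_concat \<rho> \<gamma>') \<in> Eqv T"
    and pixel_partition_exists: "\<gamma> \<in> Paths T \<Longrightarrow> \<exists>Is Xs. pixel_partition P \<gamma> Is Xs"
    and pixel_partition_Eqv:
      "\<lbrakk>\<gamma> \<in> Paths T; \<gamma>' \<in> Paths T; \<gamma> 0 = \<gamma>' 0; \<gamma> 1 = \<gamma>' 1;
        pixel_partition P \<gamma> Is Xs; pixel_partition P \<gamma>' Is Xs\<rbrakk> \<Longrightarrow> (\<gamma>, \<gamma>') \<in> Eqv T"

section \<open>Pixelation\<close>

type_synonym 'x loc_mor = "('x \<times> 'x path set zig list \<times> 'x) set"
type_synonym 'x pixel_arrow = "'x set \<times> 'x loc_mor \<times> 'x set"
type_synonym 'x pixel_mor = "('x set \<times> 'x pixel_arrow list \<times> 'x set) set"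

definition pixel_mors :: "'x triple \<Rightarrow> 'x set set \<Rightarrow> 'x path set set" where
  "pixel_mors T P = {path_class T \<rho> |\<rho>. \<rho> \<in> Paths T \<and> in_pixel P \<rho>}"

definition path_loc :: "'x triple \<Rightarrow> 'x set set \<Rightarrow> ('x, 'x loc_mor) cat" where
  "path_loc T P = localization (path_cat T) (pixel_mors T P)"

definition path_loc_functor ::
    "'x triple \<Rightarrow> 'x set set \<Rightarrow> ('x, 'x path set, 'x, 'x loc_mor) fun_data" where
  "path_loc_functor T P = loc_functor (path_cat T) (pixel_mors T P)"

text \<open>\<open>left_fraction T P \<rho> \<gamma>\<close> is \<open>[\<rho>]\<^sup>-\<^sup>1[\<gamma>]\<close>.\<close>

definition left_fraction :: "'x triple \<Rightarrow> 'x set set \<Rightarrow> 'x path \<Rightarrow> 'x path \<Rightarrow> 'x loc_mor" where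
  "left_fraction T P \<rho> \<gamma> =
     Cmp (path_loc T P)
       (loc_inverse (path_cat T) (pixel_mors T P) (path_class T \<rho>))
       (Fmo (path_loc_functor T P) (path_class T \<gamma>))"

definition pseudo_arrows :: "'x triple \<Rightarrow> 'x set set \<Rightarrow> 'x \<Rightarrow> 'x \<Rightarrow> 'x loc_mor set" where
  "pseudo_arrows T P x y =
     {left_fraction T P \<rho> \<gamma> |\<rho> \<gamma>. \<rho> \<in> Paths T \<and> \<gamma> \<in> Paths T \<and> in_pixel P \<rho> \<and>
        \<gamma> 0 = x \<and> \<gamma> 1 = \<rho> 1 \<and> \<rho> 0 = y \<and>
        (\<exists>Is Xs. pixel_partition P \<gamma> Is Xs \<and> length Is = 2)}"

text \<open>\<open>s X\<close> is the chosen point of the pixel \<open>X\<close>.\<close>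

definition pixel_quiver ::
    "'x triple \<Rightarrow> 'x set set \<Rightarrow> ('x set \<Rightarrow> 'x) \<Rightarrow> ('x set, 'x pixel_arrow) quiver" where
  "pixel_quiver T P s = \<lparr>
     Vert = P,
     Arr = {(X, \<alpha>, Y). X \<in> P \<and> Y \<in> P \<and> \<alpha> \<in> pseudo_arrows T P (s X) (s Y)},
     Src = (\<lambda>a. fst a),
     Tgt = (\<lambda>a. snd (snd a))\<rparr>"

text \<open>The functor usually called \<open>\<Psi>\<close>.\<close>

definition pixel_realization ::
    "'x triple \<Rightarrow> 'x set set \<Rightarrow> ('x set \<Rightarrow> 'x) \<Rightarrow>
     ('x set, 'x set \<times> 'x pixel_arrow list \<times> 'x set, 'x, 'x loc_mor) fun_data" where
  "pixel_realization T P s =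
     free_functor (pixel_quiver T P s) (path_loc T P) s (\<lambda>a. fst (snd a))"

definition pixel_kernel ::
    "'x triple \<Rightarrow> 'x set set \<Rightarrow> ('x set \<Rightarrow> 'x) \<Rightarrow>
     (('x set \<times> 'x pixel_arrow list \<times> 'x set) \<times> ('x set \<times> 'x pixel_arrow list \<times> 'x set)) set" where
  "pixel_kernel T P s =
     functor_kernel (free_cat (pixel_quiver T P s)) (pixel_realization T P s)"

definition pixelation ::
    "'x triple \<Rightarrow> 'x set set \<Rightarrow> ('x set \<Rightarrow> 'x) \<Rightarrow> ('x set, 'x pixel_mor) cat" where
  "pixelation T P s = quot_cat (free_cat (pixel_quiver T P s)) (pixel_kernel T P s)"

definition pixelation_arrow ::
    "'x triple \<Rightarrow> 'x set set \<Rightarrow> ('x set \<Rightarrow> 'x) \<Rightarrow> 'x pixel_arrow \<Rightarrow> 'x pixel_mor" where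
  "pixelation_arrow T P s a = pixel_kernel T P s `` {free_arrow (pixel_quiver T P s) a}"

text \<open>The defining properties of the equivalence \<open>H\<close> from the localization to the pixelation: it
  sends a point to its pixel, a morphism \<open>[\<rho>]\<^sup>-\<^sup>1[\<rho>']\<close> inside a pixel to an identity, and a pseudo
  arrow from a point of \<open>X\<close> to a point of \<open>Y\<close> to the arrow of the quiver from \<open>X\<close> to \<open>Y\<close>.\<close>

definition is_pixel_equivalence ::
    "'x triple \<Rightarrow> 'x set set \<Rightarrow> ('x set \<Rightarrow> 'x) \<Rightarrow>
     ('x, 'x loc_mor, 'x set, 'x pixel_mor) fun_data \<Rightarrow> bool" where
  "is_pixel_equivalence T P s H \<longleftrightarrow>
     is_equivalence (path_loc T P) (pixelation T P s) H \<and>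
     (\<forall>X\<in>P. \<forall>x\<in>X. Fob H x = X) \<and>
     (\<forall>X\<in>P. \<forall>\<rho>\<in>Paths T. \<forall>\<rho>'\<in>Paths T. path_im \<rho> \<subseteq> X \<and> path_im \<rho>' \<subseteq> X \<and> \<rho> 1 = \<rho>' 1 \<longrightarrow>
        Fmo H (left_fraction T P \<rho> \<rho>') = Ide (pixelation T P s) X) \<and>
     (\<forall>X\<in>P. \<forall>Y\<in>P. \<forall>x\<in>X. \<forall>y\<in>Y. \<forall>\<alpha>\<in>pseudo_arrows T P x y.
        \<exists>a\<in>Arr (pixel_quiver T P s).
          Src (pixel_quiver T P s) a = X \<and> Tgt (pixel_quiver T P s) a = Y \<and>
          Fmo H \<alpha> = pixelation_arrow T P s a)"

text \<open>The composite \<open>Hp\<close>.\<close>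

definition pixelation_functor ::
    "'x triple \<Rightarrow> 'x set set \<Rightarrow> ('x, 'x loc_mor, 'x set, 'x pixel_mor) fun_data \<Rightarrow>
     ('x, 'x path set, 'x set, 'x pixel_mor) fun_data" where
  "pixelation_functor T P H = comp_functor H (path_loc_functor T P)"

end

theory Submission
  imports Defs
begin

text \<open>Axiom (f) of a triple makes every morphism of the path category both mono and epi. Hence \<open>p\<close> is
  faithful, and by the Ore condition any two morphisms of the localization with a common source come
  from the path category after composition with an isomorphism. Together with the same property
  of the equivalence \<open>H\<close>, this lets pullback squares be tested in the path category, so \<open>Hp\<close>
  preserves pullbacks. The sheaf condition for a covering of the path category is then the one for its image,
  except that members of the covering may be identified by \<open>Hp\<close>; a matching family takes equal values
  on such members, by restriction along the diagonal.\<close>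

section \<open>Categories and functors\<close>

text \<open>Write \<open>K\<close> for the composite functor Hp. A sheaf on the pixelation controls
  only fibre products taken there, so a comparison with \<open>path_cat T\<close> needs the images
  under \<open>K\<close> of the fibre products of a covering to be fibre products again. The
  obstacle is that their universal property ranges over morphisms that are classes of zigzags.
  Precomposing a competing cone with an isomorphism does not change whether it factors, so both legs
  may be taken to be images under \<open>K\<close>; their commutation then descends by faithfulness,
  and the pullback in \<open>path_cat T\<close> applies.

  Faithfulness of \<open>p\<close> is the delicate point: equality in the localization is a
  generated congruence, and a derivation may pass through arbitrary zigzags. An invariant of zigzags
  is needed that every step of a derivation respects. Cancellation supplies it: a zigzag acts
  partially on morphisms, a forward letter by composition and a backward letter by division, and the
  value of the zigzag \<open>[Fwd f]\<close> at an identity is \<open>f\<close> itself.\<close>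

lemma
  assumes "is_category C"
  shows Dom_in_Obj: "f \<in> Mor C \<Longrightarrow> Dom C f \<in> Obj C"
    and Cod_in_Obj: "f \<in> Mor C \<Longrightarrow> Cod C f \<in> Obj C"
    and Ide_in_Mor: "x \<in> Obj C \<Longrightarrow> Ide C x \<in> Mor C"
    and Dom_Ide: "x \<in> Obj C \<Longrightarrow> Dom C (Ide C x) = x"
    and Cod_Ide: "x \<in> Obj C \<Longrightarrow> Cod C (Ide C x) = x"
    and Cmp_in_Mor: "f \<in> Mor C \<Longrightarrow> g \<in> Mor C \<Longrightarrow> Cod C f = Dom C g \<Longrightarrow> Cmp C g f \<in> Mor C"
    and Dom_Cmp: "f \<in> Mor C \<Longrightarrow> g \<in> Mor C \<Longrightarrow> Cod C f = Dom C g \<Longrightarrow> Dom C (Cmp C g f) = Dom C f"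
    and Cod_Cmp: "f \<in> Mor C \<Longrightarrow> g \<in> Mor C \<Longrightarrow> Cod C f = Dom C g \<Longrightarrow> Cod C (Cmp C g f) = Cod C g"
    and Cmp_Ide_right: "f \<in> Mor C \<Longrightarrow> Dom C f = x \<Longrightarrow> Cmp C f (Ide C x) = f"
    and Cmp_Ide_left: "f \<in> Mor C \<Longrightarrow> Cod C f = y \<Longrightarrow> Cmp C (Ide C y) f = f"
    and Cmp_assoc: "f \<in> Mor C \<Longrightarrow> g \<in> Mor C \<Longrightarrow> h \<in> Mor C \<Longrightarrow> Cod C f = Dom C g \<Longrightarrow>
      Cod C g = Dom C h \<Longrightarrow> Cmp C (Cmp C h g) f = Cmp C h (Cmp C g f)"
  using assms unfolding is_category_def by auto

lemmas category_simps =
  Dom_in_Obj Cod_in_Obj Ide_in_Mor Dom_Ide Cod_Ide Cmp_in_Mor Dom_Cmp Cod_Cmp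
  Cmp_Ide_right Cmp_Ide_left Cmp_assoc

lemma
  assumes "is_functor C D F"
  shows Fob_in_Obj: "x \<in> Obj C \<Longrightarrow> Fob F x \<in> Obj D"
    and Fmo_Ide: "x \<in> Obj C \<Longrightarrow> Fmo F (Ide C x) = Ide D (Fob F x)"
    and Fmo_in_Mor: "f \<in> Mor C \<Longrightarrow> Fmo F f \<in> Mor D"
    and Dom_Fmo: "f \<in> Mor C \<Longrightarrow> Dom D (Fmo F f) = Fob F (Dom C f)"
    and Cod_Fmo: "f \<in> Mor C \<Longrightarrow> Cod D (Fmo F f) = Fob F (Cod C f)"
    and Fmo_Cmp: "f \<in> Mor C \<Longrightarrow> g \<in> Mor C \<Longrightarrow> Cod C f = Dom C g \<Longrightarrow>
      Fmo F (Cmp C g f) = Cmp D (Fmo F g) (Fmo F f)"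
  using assms unfolding is_functor_def by auto

lemmas functor_simps = Fob_in_Obj Fmo_Ide Fmo_in_Mor Dom_Fmo Cod_Fmo

lemma comp_functor_simps [simp]:
  "Fob (comp_functor G F) x = Fob G (Fob F x)" "Fmo (comp_functor G F) f = Fmo G (Fmo F f)"
  by (simp_all add: comp_functor_def)

lemma id_functor_simps [simp]: "Fob id_functor x = x" "Fmo id_functor f = f"
  by (simp_all add: id_functor_def)

lemma is_functor_comp:
  assumes "is_functor C D F" "is_functor D E G"
  shows "is_functor C E (comp_functor G F)"
  using assms unfolding is_functor_def by simp

lemma is_isoE:
  assumes "is_iso C f"
  obtains g where "f \<in> Mor C" "g \<in> Mor C" "Dom C g = Cod C f" "Cod C g = Dom C f"
    "Cmp C g f = Ide C (Dom C f)" "Cmp C f g = Ide C (Cod C f)"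
  using assms unfolding is_iso_def by blast

lemma is_iso_in_Mor: "is_iso C f \<Longrightarrow> f \<in> Mor C"
  by (simp add: is_iso_def)

lemma is_iso_Cmp:
  assumes C: "is_category C" and f: "is_iso C f" and g: "is_iso C g" and "Cod C f = Dom C g"
  shows "is_iso C (Cmp C g f)"
proof -
  obtain f' where f': "f \<in> Mor C" "f' \<in> Mor C" "Dom C f' = Cod C f" "Cod C f' = Dom C f"
    "Cmp C f' f = Ide C (Dom C f)" "Cmp C f f' = Ide C (Cod C f)"
    using f by (rule is_isoE)
  obtain g' where g': "g \<in> Mor C" "g' \<in> Mor C" "Dom C g' = Cod C g" "Cod C g' = Dom C g"
    "Cmp C g' g = Ide C (Dom C g)" "Cmp C g g' = Ide C (Cod C g)"
    using g by (rule is_isoE)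
  have "Cmp C g' (Cmp C g f) = f" "Cmp C f (Cmp C f' g') = g'"
    using f' g' assms(4) Cmp_assoc[OF C, of f g g'] Cmp_assoc[OF C, of g' f' f]
    by (simp_all add: category_simps[OF C])
  then show ?thesis
    unfolding is_iso_def using f' g' assms(4)
    by (intro conjI bexI[of _ "Cmp C f' g'"]) (simp_all add: category_simps[OF C])
qed

lemma is_iso_Fmo:
  assumes C: "is_category C" and F: "is_functor C D F" and f: "is_iso C f"
  shows "is_iso D (Fmo F f)"
proof -
  obtain g where g: "f \<in> Mor C" "g \<in> Mor C" "Dom C g = Cod C f" "Cod C g = Dom C f"
    "Cmp C g f = Ide C (Dom C f)" "Cmp C f g = Ide C (Cod C f)"
    using f by (rule is_isoE)
  then show ?thesis
    unfolding is_iso_def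
    by (intro conjI bexI[of _ "Fmo F g"])
      (simp_all add: functor_simps[OF F] Fmo_Cmp[OF F, symmetric] category_simps[OF C])
qed

lemma iso_cancel_right:
  assumes C: "is_category C" and u: "is_iso C u" and "f \<in> Mor C" "g \<in> Mor C"
    and "Dom C f = Cod C u" "Dom C g = Cod C u" and eq: "Cmp C f u = Cmp C g u"
  shows "f = g"
proof -
  obtain v where v: "u \<in> Mor C" "v \<in> Mor C" "Dom C v = Cod C u" "Cod C v = Dom C u"
    "Cmp C v u = Ide C (Dom C u)" "Cmp C u v = Ide C (Cod C u)"
    using u by (rule is_isoE)
  have "Cmp C f (Cmp C u v) = Cmp C g (Cmp C u v)"
    using eq v assms(3-6) Cmp_assoc[OF C, of v u f] Cmp_assoc[OF C, of v u g] by simp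
  then show ?thesis
    using v assms(3-6) by (simp add: category_simps[OF C])
qed

lemma iso_cancel_left:
  assumes C: "is_category C" and u: "is_iso C u" and "f \<in> Mor C" "g \<in> Mor C"
    and "Cod C f = Dom C u" "Cod C g = Dom C u" and eq: "Cmp C u f = Cmp C u g"
  shows "f = g"
proof -
  obtain v where v: "u \<in> Mor C" "v \<in> Mor C" "Dom C v = Cod C u" "Cod C v = Dom C u"
    "Cmp C v u = Ide C (Dom C u)" "Cmp C u v = Ide C (Cod C u)"
    using u by (rule is_isoE)
  have "Cmp C (Cmp C v u) f = Cmp C (Cmp C v u) g"
    using eq v(1-4) assms(3-6) by (simp add: category_simps[OF C])
  then show ?thesis
    using v assms(3-6) by (simp add: category_simps[OF C])
qed

section \<open>Equivalences are faithful and full\<close>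

definition faithful :: "('o, 'm) cat \<Rightarrow> ('o, 'm, 'p, 'n) fun_data \<Rightarrow> bool" where
  "faithful C F \<longleftrightarrow> (\<forall>f\<in>Mor C. \<forall>g\<in>Mor C.
     Dom C f = Dom C g \<and> Cod C f = Cod C g \<and> Fmo F f = Fmo F g \<longrightarrow> f = g)"

lemma faithfulD:
  "\<lbrakk>faithful C F; f \<in> Mor C; g \<in> Mor C; Dom C f = Dom C g; Cod C f = Cod C g; Fmo F f = Fmo F g\<rbrakk>
    \<Longrightarrow> f = g"
  by (simp add: faithful_def)

lemma faithful_comp:
  assumes "is_functor C D F" "faithful C F" "faithful D G"
  shows "faithful C (comp_functor G F)"
  using assms unfolding faithful_def is_functor_def by simp

lemma
  assumes "is_natural_iso C D F G \<eta>"
  shows natural_iso_component: "x \<in> Obj C \<Longrightarrow> is_iso D (\<eta> x) \<and> \<eta> x \<in> Mor D \<and>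
      Dom D (\<eta> x) = Fob F x \<and> Cod D (\<eta> x) = Fob G x"
    and natural_iso_square: "f \<in> Mor C \<Longrightarrow>
      Cmp D (\<eta> (Cod C f)) (Fmo F f) = Cmp D (Fmo G f) (\<eta> (Dom C f))"
  using assms unfolding is_natural_iso_def is_iso_def by blast+

text \<open>By naturality, \<open>Fmo F f\<close> determines the composite of \<open>f\<close> with
  a component of \<eta>, and that component can be cancelled.\<close>

lemma natural_iso_from_id_faithful:
  assumes C: "is_category C" and F: "is_functor C C F"
    and \<eta>: "is_natural_iso C C id_functor F \<eta>"
  shows "faithful C F"
  unfolding faithful_def
proof (intro ballI impI; elim conjE)
  fix f g assume fg: "f \<in> Mor C" "g \<in> Mor C" "Dom C f = Dom C g" "Cod C f = Cod C g"
    "Fmo F f = Fmo F g"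
  have eq: "Cmp C (\<eta> (Cod C f)) f = Cmp C (\<eta> (Cod C f)) g"
    using natural_iso_square[OF \<eta> fg(1)] natural_iso_square[OF \<eta> fg(2)] fg by simp
  show "f = g"
    by (rule iso_cancel_left[OF C _ fg(1,2) _ _ eq])
      (use natural_iso_component[OF \<eta> Cod_in_Obj[OF C fg(1)]] fg in simp_all)
qed

lemma natural_iso_to_id_faithful:
  assumes C: "is_category C" and F: "is_functor C C F"
    and \<epsilon>: "is_natural_iso C C F id_functor \<epsilon>"
  shows "faithful C F"
  unfolding faithful_def
proof (intro ballI impI; elim conjE)
  fix f g assume fg: "f \<in> Mor C" "g \<in> Mor C" "Dom C f = Dom C g" "Cod C f = Cod C g"
    "Fmo F f = Fmo F g"
  have eq: "Cmp C f (\<epsilon> (Dom C f)) = Cmp C g (\<epsilon> (Dom C f))"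
    using natural_iso_square[OF \<epsilon> fg(1)] natural_iso_square[OF \<epsilon> fg(2)] fg by simp
  show "f = g"
    by (rule iso_cancel_right[OF C _ fg(1,2) _ _ eq])
      (use natural_iso_component[OF \<epsilon> Dom_in_Obj[OF C fg(1)]] fg in simp_all)
qed

text \<open>The composite with the quasi-inverse is faithful, being isomorphic to the identity, and
  a faithful composite has a faithful first factor.\<close>

lemma equivalence_faithful:
  assumes "is_category C" "is_category D" "is_equivalence C D F"
  shows "faithful C F"
proof -
  obtain G \<eta> where G: "is_functor D C G" "is_natural_iso C C id_functor (comp_functor G F) \<eta>"
    using assms unfolding is_equivalence_def by blast
  have "faithful C (comp_functor G F)"
    using natural_iso_from_id_faithful[OF assms(1) _ G(2)] is_functor_comp G(1) assms(3)
    unfolding is_equivalence_def by blast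
  then show ?thesis
    by (simp add: faithful_def)
qed

text \<open>Conjugating the image of \<alpha> under the quasi-inverse \<open>G\<close> by \<eta>
  gives the candidate. Naturality identifies its image with \<alpha> only after applying
  \<open>G\<close>, so faithfulness of \<open>G\<close>, obtained from \<epsilon>, is needed to
  conclude.\<close>

lemma equivalence_full:
  assumes C: "is_category C" and D: "is_category D" and eqv: "is_equivalence C D F"
    and xy: "x \<in> Obj C" "y \<in> Obj C"
    and \<alpha>: "\<alpha> \<in> Mor D" "Dom D \<alpha> = Fob F x" "Cod D \<alpha> = Fob F y"
  shows "\<exists>f\<in>Mor C. Dom C f = x \<and> Cod C f = y \<and> Fmo F f = \<alpha>"
proof -
  obtain G \<eta> \<epsilon> where F: "is_functor C D F" and G: "is_functor D C G"
    and \<eta>: "is_natural_iso C C id_functor (comp_functor G F) \<eta>"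
    and \<epsilon>: "is_natural_iso D D (comp_functor F G) id_functor \<epsilon>"
    using eqv unfolding is_equivalence_def by blast
  have "faithful D (comp_functor F G)"
    using natural_iso_to_id_faithful[OF D _ \<epsilon>] is_functor_comp[OF G F] by blast
  then have G_faithful: "faithful D G"
    by (simp add: faithful_def)
  have \<eta>x: "is_iso C (\<eta> x)" "\<eta> x \<in> Mor C" "Dom C (\<eta> x) = x" "Cod C (\<eta> x) = Fob G (Fob F x)"
    and \<eta>y: "is_iso C (\<eta> y)" "Dom C (\<eta> y) = y" "Cod C (\<eta> y) = Fob G (Fob F y)"
    using xy[THEN natural_iso_component[OF \<eta>]] by simp_all
  obtain \<eta>' where \<eta>': "\<eta> y \<in> Mor C" "\<eta>' \<in> Mor C" "Dom C \<eta>' = Cod C (\<eta> y)" "Cod C \<eta>' = y"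
    "Cmp C (\<eta> y) \<eta>' = Ide C (Cod C (\<eta> y))"
    using \<eta>y is_isoE by metis
  have G\<alpha>: "Fmo G \<alpha> \<in> Mor C" "Dom C (Fmo G \<alpha>) = Fob G (Fob F x)" "Cod C (Fmo G \<alpha>) = Fob G (Fob F y)"
    using \<alpha> by (simp_all add: functor_simps[OF G])
  \<comment> \<open>\<open>\<eta>'\<close> is the inverse of \<open>\<eta> y\<close>, so this is the
    only morphism that makes the naturality square with \<open>Fmo G \<alpha>\<close>
    commute.\<close>
  define f where "f = Cmp C \<eta>' (Cmp C (Fmo G \<alpha>) (\<eta> x))"
  have f: "f \<in> Mor C" "Dom C f = x" "Cod C f = y"
    using \<eta>x \<eta>y \<eta>' G\<alpha> unfolding f_def by (simp_all add: category_simps[OF C])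
  have "Cmp C (\<eta> y) f = Cmp C (Fmo G \<alpha>) (\<eta> x)"
    using \<eta>x \<eta>y \<eta>' G\<alpha> Cmp_assoc[OF C, of "Cmp C (Fmo G \<alpha>) (\<eta> x)" \<eta>' "\<eta> y"] unfolding f_def
    by (simp add: category_simps[OF C])
  moreover have "Cmp C (\<eta> y) f = Cmp C (Fmo G (Fmo F f)) (\<eta> x)"
    using natural_iso_square[OF \<eta> f(1)] f by simp
  ultimately have "Cmp C (Fmo G (Fmo F f)) (\<eta> x) = Cmp C (Fmo G \<alpha>) (\<eta> x)"
    by simp
  then have "Fmo G (Fmo F f) = Fmo G \<alpha>"
    by (rule iso_cancel_right[OF C \<eta>x(1), rotated -1])
      (use \<eta>x G\<alpha> f in \<open>simp_all add: functor_simps[OF F] functor_simps[OF G]\<close>)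
  then have "Fmo F f = \<alpha>"
    by (rule faithfulD[OF G_faithful, rotated -1]) (use f \<alpha> in \<open>simp_all add: functor_simps[OF F]\<close>)
  then show ?thesis
    using f by (intro bexI[of _ f] conjI)
qed

section \<open>Preservation of pullbacks\<close>

definition preserves_pullbacks ::
    "('o, 'm) cat \<Rightarrow> ('p, 'n) cat \<Rightarrow> ('o, 'm, 'p, 'n) fun_data \<Rightarrow> bool" where
  "preserves_pullbacks C D F \<longleftrightarrow> (\<forall>f g p q. is_pullback C f g p q \<longrightarrow>
     is_pullback D (Fmo F f) (Fmo F g) (Fmo F p) (Fmo F q))"

text \<open>The condition shared by equivalences and by localizations with a calculus of right fractions:
  the comma category of \<open>F\<close> over \<open>d\<close> has enough isomorphisms to bring any two morphisms
  out of \<open>d\<close> into the image of \<open>F\<close> simultaneously.\<close>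

definition lifts_spans :: "('o, 'm) cat \<Rightarrow> ('p, 'n) cat \<Rightarrow> ('o, 'm, 'p, 'n) fun_data \<Rightarrow> bool" where
  "lifts_spans C D F \<longleftrightarrow> (\<forall>a\<in>Obj C. \<forall>b\<in>Obj C. \<forall>\<alpha>\<in>Mor D. \<forall>\<beta>\<in>Mor D.
     Dom D \<alpha> = Dom D \<beta> \<and> Cod D \<alpha> = Fob F a \<and> Cod D \<beta> = Fob F b \<longrightarrow>
     (\<exists>z\<in>Obj C. \<exists>u. \<exists>k\<in>Mor C. \<exists>l\<in>Mor C. is_iso D u \<and> Dom D u = Fob F z \<and> Cod D u = Dom D \<alpha> \<and>
        Dom C k = z \<and> Cod C k = a \<and> Dom C l = z \<and> Cod C l = b \<and>
        Cmp D \<alpha> u = Fmo F k \<and> Cmp D \<beta> u = Fmo F l))"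

lemma lifts_spansE:
  assumes "lifts_spans C D F" "a \<in> Obj C" "b \<in> Obj C" "\<alpha> \<in> Mor D" "\<beta> \<in> Mor D"
    "Dom D \<alpha> = Dom D \<beta>" "Cod D \<alpha> = Fob F a" "Cod D \<beta> = Fob F b"
  obtains z u k l where "z \<in> Obj C" "is_iso D u" "Dom D u = Fob F z" "Cod D u = Dom D \<alpha>"
    "k \<in> Mor C" "Dom C k = z" "Cod C k = a" "l \<in> Mor C" "Dom C l = z" "Cod C l = b"
    "Cmp D \<alpha> u = Fmo F k" "Cmp D \<beta> u = Fmo F l"
proof -
  have "\<exists>z\<in>Obj C. \<exists>u. \<exists>k\<in>Mor C. \<exists>l\<in>Mor C. is_iso D u \<and> Dom D u = Fob F z \<and> Cod D u = Dom D \<alpha> \<and>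
        Dom C k = z \<and> Cod C k = a \<and> Dom C l = z \<and> Cod C l = b \<and>
        Cmp D \<alpha> u = Fmo F k \<and> Cmp D \<beta> u = Fmo F l"
    using assms(1)[unfolded lifts_spans_def, rule_format, OF assms(2-5)] assms(6-8) by blast
  then show thesis
    using that by blast
qed

text \<open>The span is lifted along \<open>G\<close> to a span in \<open>D\<close>, which is then
  lifted along \<open>F\<close>; the two isomorphisms are composed after moving the second one to
  \<open>E\<close> by \<open>G\<close>.\<close>

lemma lifts_spans_comp:
  assumes D: "is_category D" and E: "is_category E"
    and F: "is_functor C D F" and G: "is_functor D E G"
    and "lifts_spans C D F" and "lifts_spans D E G"
  shows "lifts_spans C E (comp_functor G F)"
  unfolding lifts_spans_def
proof (intro ballI impI; elim conjE)
  fix a b \<alpha> \<beta>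
  assume ab: "a \<in> Obj C" "b \<in> Obj C" and \<alpha>\<beta>: "\<alpha> \<in> Mor E" "\<beta> \<in> Mor E" "Dom E \<alpha> = Dom E \<beta>"
    and "Cod E \<alpha> = Fob (comp_functor G F) a" "Cod E \<beta> = Fob (comp_functor G F) b"
  then have cod: "Cod E \<alpha> = Fob G (Fob F a)" "Cod E \<beta> = Fob G (Fob F b)"
    by simp_all
  obtain d u k l where d: "d \<in> Obj D" "is_iso E u" "Dom E u = Fob G d" "Cod E u = Dom E \<alpha>"
    and k: "k \<in> Mor D" "Dom D k = d" "Cod D k = Fob F a"
    and l: "l \<in> Mor D" "Dom D l = d" "Cod D l = Fob F b"
    and u: "Cmp E \<alpha> u = Fmo G k" "Cmp E \<beta> u = Fmo G l"
    by (rule lifts_spansE[OF assms(6) ab[THEN Fob_in_Obj[OF F]] \<alpha>\<beta> cod])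
  obtain z v k' l' where z: "z \<in> Obj C" "is_iso D v" "Dom D v = Fob F z" "Cod D v = Dom D k"
    and k': "k' \<in> Mor C" "Dom C k' = z" "Cod C k' = a"
    and l': "l' \<in> Mor C" "Dom C l' = z" "Cod C l' = b"
    and v: "Cmp D k v = Fmo F k'" "Cmp D l v = Fmo F l'"
    by (rule lifts_spansE[OF assms(5) ab k(1) l(1) HOL.trans[OF k(2) l(2)[symmetric]] k(3) l(3)])
  have [simp]: "u \<in> Mor E" "v \<in> Mor D"
    using d(2) z(2) by (auto intro: is_iso_in_Mor)
  let ?w = "Cmp E u (Fmo G v)"
  have "is_iso E ?w"
    using is_iso_Cmp[OF E is_iso_Fmo[OF D G z(2)] d(2)] z d k by (simp add: functor_simps[OF G])
  moreover have "Dom E ?w = Fob G (Fob F z)" "Cod E ?w = Dom E \<alpha>"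
    using z d k by (simp_all add: functor_simps[OF G] category_simps[OF E])
  moreover have "Cmp E \<alpha> ?w = Fmo G (Fmo F k')"
    using \<alpha>\<beta> cod z d k u v Cmp_assoc[OF E, of "Fmo G v" u \<alpha>] Fmo_Cmp[OF G, of v k]
    by (simp add: functor_simps[OF G])
  moreover have "Cmp E \<beta> ?w = Fmo G (Fmo F l')"
    using \<alpha>\<beta> cod z d k l u v Cmp_assoc[OF E, of "Fmo G v" u \<beta>] Fmo_Cmp[OF G, of v l]
    by (simp add: functor_simps[OF G])
  ultimately show "\<exists>z\<in>Obj C. \<exists>u. \<exists>k\<in>Mor C. \<exists>l\<in>Mor C. is_iso E u \<and>
    Dom E u = Fob (comp_functor G F) z \<and> Cod E u = Dom E \<alpha> \<and>
    Dom C k = z \<and> Cod C k = a \<and> Dom C l = z \<and> Cod C l = b \<and>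
    Cmp E \<alpha> u = Fmo (comp_functor G F) k \<and> Cmp E \<beta> u = Fmo (comp_functor G F) l"
    unfolding comp_functor_simps using z(1) k' l' by blast
qed

text \<open>The counit at the common source is an isomorphism from an object in the image of
  \<open>F\<close>; after composition with it, both morphisms run between images of objects and lift
  by fullness.\<close>

lemma equivalence_lifts_spans:
  assumes C: "is_category C" and D: "is_category D" and eqv: "is_equivalence C D F"
  shows "lifts_spans C D F"
  unfolding lifts_spans_def
proof (intro ballI impI; elim conjE)
  fix a b \<alpha> \<beta>
  assume ab: "a \<in> Obj C" "b \<in> Obj C" and \<alpha>\<beta>: "\<alpha> \<in> Mor D" "\<beta> \<in> Mor D" "Dom D \<alpha> = Dom D \<beta>"
    "Cod D \<alpha> = Fob F a" "Cod D \<beta> = Fob F b"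
  obtain G \<epsilon> where G: "is_functor D C G"
    and \<epsilon>: "is_natural_iso D D (comp_functor F G) id_functor \<epsilon>"
    using eqv unfolding is_equivalence_def by blast
  define z where "z = Fob G (Dom D \<alpha>)"
  have z: "z \<in> Obj C"
    unfolding z_def using \<alpha>\<beta> by (simp add: category_simps[OF D] functor_simps[OF G])
  define u where "u = \<epsilon> (Dom D \<alpha>)"
  have u: "is_iso D u" "u \<in> Mor D" "Dom D u = Fob F z" "Cod D u = Dom D \<alpha>"
    using natural_iso_component[OF \<epsilon> Dom_in_Obj[OF D \<alpha>\<beta>(1)]] unfolding u_def z_def by simp_all
  obtain k where k: "k \<in> Mor C" "Dom C k = z" "Cod C k = a" "Fmo F k = Cmp D \<alpha> u"
    using equivalence_full[OF C D eqv z ab(1), of "Cmp D \<alpha> u"] u \<alpha>\<beta>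
    by (auto simp: category_simps[OF D])
  obtain l where l: "l \<in> Mor C" "Dom C l = z" "Cod C l = b" "Fmo F l = Cmp D \<beta> u"
    using equivalence_full[OF C D eqv z ab(2), of "Cmp D \<beta> u"] u \<alpha>\<beta>
    by (auto simp: category_simps[OF D])
  show "\<exists>z\<in>Obj C. \<exists>u. \<exists>k\<in>Mor C. \<exists>l\<in>Mor C. is_iso D u \<and> Dom D u = Fob F z \<and>
    Cod D u = Dom D \<alpha> \<and> Dom C k = z \<and> Cod C k = a \<and> Dom C l = z \<and> Cod C l = b \<and>
    Cmp D \<alpha> u = Fmo F k \<and> Cmp D \<beta> u = Fmo F l"
    by (rule bexI[OF _ z], rule exI[of _ u], rule bexI[OF _ k(1)], rule bexI[OF _ l(1)])
      (simp add: u k l)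
qed

lemma pullbackE:
  assumes "is_pullback C f g p q" "p' \<in> Mor C" "q' \<in> Mor C" "Dom C p' = Dom C q'"
    "Cod C p' = Dom C f" "Cod C q' = Dom C g" "Cmp C f p' = Cmp C g q'"
  obtains h where "h \<in> Mor C" "Dom C h = Dom C p'" "Cod C h = Dom C p"
    "Cmp C p h = p'" "Cmp C q h = q'"
  using assms unfolding is_pullback_def by blast

text \<open>The projections of a pullback are jointly monic: both morphisms mediate the same cone,
  the one with legs \<open>Cmp C p h\<close> and \<open>Cmp C q h\<close>.\<close>

lemma pullback_unique:
  assumes C: "is_category C" and pb: "is_pullback C f g p q"
    and h: "h \<in> Mor C" "h' \<in> Mor C" "Dom C h = Dom C h'" "Cod C h = Dom C p" "Cod C h' = Dom C p"
    and eq: "Cmp C p h = Cmp C p h'" "Cmp C q h = Cmp C q h'"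
  shows "h = h'"
proof -
  have *: "f \<in> Mor C" "g \<in> Mor C" "p \<in> Mor C" "q \<in> Mor C" "Dom C p = Dom C q"
      "Cod C p = Dom C f" "Cod C q = Dom C g" "Cmp C f p = Cmp C g q"
    using pb unfolding is_pullback_def by blast+
  have "Cmp C f (Cmp C p h) = Cmp C (Cmp C f p) h" "Cmp C g (Cmp C q h) = Cmp C (Cmp C g q) h"
    using *(1-7) h by (auto intro!: Cmp_assoc[OF C, symmetric])
  then have comm: "Cmp C f (Cmp C p h) = Cmp C g (Cmp C q h)"
    using *(8) by simp
  have uniq: "\<And>p' q'. \<lbrakk>p' \<in> Mor C; q' \<in> Mor C; Dom C p' = Dom C q'; Cod C p' = Dom C f;
      Cod C q' = Dom C g; Cmp C f p' = Cmp C g q'\<rbrakk> \<Longrightarrow>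
      \<exists>!k. k \<in> Mor C \<and> Dom C k = Dom C p' \<and> Cod C k = Dom C p \<and> Cmp C p k = p' \<and> Cmp C q k = q'"
    using pb unfolding is_pullback_def by blast
  have mor: "Cmp C p h \<in> Mor C" "Cmp C q h \<in> Mor C" "Dom C (Cmp C p h) = Dom C h"
    "Dom C (Cmp C q h) = Dom C h" "Cod C (Cmp C p h) = Dom C f" "Cod C (Cmp C q h) = Dom C g"
    using *(1-7) h by (simp_all add: category_simps[OF C])
  have "\<exists>!k. k \<in> Mor C \<and> Dom C k = Dom C h \<and> Cod C k = Dom C p \<and>
      Cmp C p k = Cmp C p h \<and> Cmp C q k = Cmp C q h"
    using uniq[OF mor(1,2) HOL.trans[OF mor(3) mor(4)[symmetric]] mor(5,6) comm]
    unfolding mor(3) .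
  moreover have "Dom C h' = Dom C h" "Cmp C p h' = Cmp C p h" "Cmp C q h' = Cmp C q h"
    using h eq by simp_all
  ultimately show ?thesis
    using h by blast
qed

text \<open>Lifting spans is used twice: on the two legs of a cone, to find a mediating morphism,
  and on two mediating morphisms, to show that they agree. Faithfulness brings the required
  equations down to \<open>C\<close>.\<close>

lemma lifts_spans_preserves_pullbacks:
  assumes C: "is_category C" and D: "is_category D" and F: "is_functor C D F"
    and faithful: "faithful C F" and spans: "lifts_spans C D F"
  shows "preserves_pullbacks C D F"
  unfolding preserves_pullbacks_def
proof (intro allI impI)
  fix f g p q assume pb: "is_pullback C f g p q"
  then have *: "f \<in> Mor C" "g \<in> Mor C" "Cod C f = Cod C g" "p \<in> Mor C" "q \<in> Mor C"
      "Dom C p = Dom C q" "Cod C p = Dom C f" "Cod C q = Dom C g" "Cmp C f p = Cmp C g q"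
    unfolding is_pullback_def by blast+
  note Fs = functor_simps[OF F] and Cs = category_simps[OF C] and Ds = category_simps[OF D]
  have "\<exists>!h. h \<in> Mor D \<and> Dom D h = Dom D \<alpha> \<and> Cod D h = Dom D (Fmo F p) \<and>
      Cmp D (Fmo F p) h = \<alpha> \<and> Cmp D (Fmo F q) h = \<beta>"
    if \<alpha>\<beta>: "\<alpha> \<in> Mor D" "\<beta> \<in> Mor D" "Dom D \<alpha> = Dom D \<beta>" "Cod D \<alpha> = Dom D (Fmo F f)"
      "Cod D \<beta> = Dom D (Fmo F g)" "Cmp D (Fmo F f) \<alpha> = Cmp D (Fmo F g) \<beta>" for \<alpha> \<beta>
  proof (rule ex_ex1I)
    have obj: "Dom C f \<in> Obj C" "Dom C g \<in> Obj C"
      and cod: "Cod D \<alpha> = Fob F (Dom C f)" "Cod D \<beta> = Fob F (Dom C g)"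
      using \<alpha>\<beta>(4,5) *(1,2) by (simp_all add: Fs Cs)
    obtain z u k l where z: "z \<in> Obj C" and u: "is_iso D u" "Dom D u = Fob F z" "Cod D u = Dom D \<alpha>"
      and k: "k \<in> Mor C" "Dom C k = z" "Cod C k = Dom C f"
      and l: "l \<in> Mor C" "Dom C l = z" "Cod C l = Dom C g"
      and kl: "Cmp D \<alpha> u = Fmo F k" "Cmp D \<beta> u = Fmo F l"
      by (rule lifts_spansE[OF spans obj \<alpha>\<beta>(1-3) cod])
    obtain v where v: "u \<in> Mor D" "v \<in> Mor D" "Dom D v = Dom D \<alpha>" "Cod D v = Fob F z"
        "Cmp D u v = Ide D (Dom D \<alpha>)"
      using is_isoE[OF u(1)] u by metis
    have "Cmp D (Fmo F f) (Cmp D \<alpha> u) = Cmp D (Cmp D (Fmo F f) \<alpha>) u"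
      "Cmp D (Fmo F g) (Cmp D \<beta> u) = Cmp D (Cmp D (Fmo F g) \<beta>) u"
      using \<alpha>\<beta>(1-5) *(1,2) u v by (auto intro!: Cmp_assoc[OF D, symmetric] simp: Fs)
    then have "Cmp D (Fmo F f) (Cmp D \<alpha> u) = Cmp D (Fmo F g) (Cmp D \<beta> u)"
      using \<alpha>\<beta>(6) by simp
    then have "Fmo F (Cmp C f k) = Fmo F (Cmp C g l)"
      using kl k l * by (simp add: Fmo_Cmp[OF F])
    then have "Cmp C f k = Cmp C g l"
      by (rule faithfulD[OF faithful, rotated -1]) (use k l *(1-8) in \<open>simp_all add: Cs\<close>)
    from pullbackE[OF pb k(1) l(1) HOL.trans[OF k(2) l(2)[symmetric]] k(3) l(3) this]
    obtain h where h: "h \<in> Mor C" "Dom C h = z" "Cod C h = Dom C p"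
        "Cmp C p h = k" "Cmp C q h = l"
      using k(2) by metis
    \<comment> \<open>The cone was precomposed with \<open>u\<close>; its inverse \<open>v\<close>
      undoes this, so the mediating morphism is the image of \<open>h\<close> after
      \<open>v\<close>.\<close>
    have "Cmp D (Fmo F p) (Cmp D (Fmo F h) v) = Cmp D (Cmp D \<alpha> u) v"
      using Cmp_assoc[OF D, of v "Fmo F h" "Fmo F p"] h v *(4-8) kl Fmo_Cmp[OF F, of h p]
      by (simp add: Fs)
    moreover have "Cmp D (Fmo F q) (Cmp D (Fmo F h) v) = Cmp D (Cmp D \<beta> u) v"
      using Cmp_assoc[OF D, of v "Fmo F h" "Fmo F q"] h v *(4-8) kl Fmo_Cmp[OF F, of h q]
      by (simp add: Fs)
    ultimately have "Cmp D (Fmo F p) (Cmp D (Fmo F h) v) = \<alpha>"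
        "Cmp D (Fmo F q) (Cmp D (Fmo F h) v) = \<beta>"
      using \<alpha>\<beta>(1-3) u v by (simp_all add: Ds)
    then show "\<exists>h. h \<in> Mor D \<and> Dom D h = Dom D \<alpha> \<and> Cod D h = Dom D (Fmo F p) \<and>
        Cmp D (Fmo F p) h = \<alpha> \<and> Cmp D (Fmo F q) h = \<beta>"
      using h(1-3) v *(4-8)
      by (intro exI[of _ "Cmp D (Fmo F h) v"] conjI) (simp_all add: Fs Ds del: Cmp_assoc[OF D])
  next
    fix h h' assume "h \<in> Mor D \<and> Dom D h = Dom D \<alpha> \<and> Cod D h = Dom D (Fmo F p) \<and>
        Cmp D (Fmo F p) h = \<alpha> \<and> Cmp D (Fmo F q) h = \<beta>"
      "h' \<in> Mor D \<and> Dom D h' = Dom D \<alpha> \<and> Cod D h' = Dom D (Fmo F p) \<and>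
        Cmp D (Fmo F p) h' = \<alpha> \<and> Cmp D (Fmo F q) h' = \<beta>"
    then have h: "h \<in> Mor D" "h' \<in> Mor D" "Dom D h = Dom D h'" "Cod D h = Fob F (Dom C p)"
        "Cod D h' = Fob F (Dom C p)"
      and eq: "Cmp D (Fmo F p) h = Cmp D (Fmo F p) h'" "Cmp D (Fmo F q) h = Cmp D (Fmo F q) h'"
      using * by (auto simp: Fs)
    have obj: "Dom C p \<in> Obj C"
      using *(4) by (simp add: Cs)
    \<comment> \<open>The span is now the pair \<open>h\<close>, \<open>h'\<close> itself, with both
      targets equal to the image of the pullback object.\<close>
    obtain z u k l where z: "z \<in> Obj C" and u: "is_iso D u" "Dom D u = Fob F z" "Cod D u = Dom D h"
      and k: "k \<in> Mor C" "Dom C k = z" "Cod C k = Dom C p"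
      and l: "l \<in> Mor C" "Dom C l = z" "Cod C l = Dom C p"
      and kl: "Cmp D h u = Fmo F k" "Cmp D h' u = Fmo F l"
      by (rule lifts_spansE[OF spans obj obj h])
    have "Cmp C r k = Cmp C r l"
      if r: "r \<in> Mor C" "Dom C r = Dom C p" "Cmp D (Fmo F r) h = Cmp D (Fmo F r) h'" for r
    proof (rule faithfulD[OF faithful])
      have "Cmp D (Fmo F r) (Cmp D h u) = Cmp D (Cmp D (Fmo F r) h) u"
        "Cmp D (Fmo F r) (Cmp D h' u) = Cmp D (Cmp D (Fmo F r) h') u"
        using r(1,2) h u is_iso_in_Mor[OF u(1)] by (auto intro!: Cmp_assoc[OF D, symmetric] simp: Fs)
      then have "Cmp D (Fmo F r) (Cmp D h u) = Cmp D (Fmo F r) (Cmp D h' u)"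
        using r(3) by simp
      then show "Fmo F (Cmp C r k) = Fmo F (Cmp C r l)"
        using kl k l r by (simp add: Fmo_Cmp[OF F])
    qed (use k l r(1,2) in \<open>simp_all add: Cs\<close>)
    from this[OF *(4) HOL.refl eq(1)] this[OF *(5) *(6)[symmetric] eq(2)]
    have "k = l"
      by (rule pullback_unique[OF C pb k(1) l(1), rotated -2]) (use k(2,3) l(2,3) in simp_all)
    with kl have "Cmp D h u = Cmp D h' u"
      by simp
    then show "h = h'"
      by (rule iso_cancel_right[OF D u(1) h(1,2), rotated -1]) (use u(3) h(3) in simp_all)
  qed
  then show "is_pullback D (Fmo F f) (Fmo F g) (Fmo F p) (Fmo F q)"
    unfolding is_pullback_def using *(1-8) arg_cong[OF *(9), of "Fmo F"]
    by (simp add: Fs Fmo_Cmp[OF F])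
qed

section \<open>Quotient categories and free categories\<close>

text \<open>These conditions make source, target and composition in \<open>quot_cat\<close>
  independent of representatives. They are stated for raw category data because they also have to
  apply to \<open>path_precat T\<close>, where the category laws are expected only up to
  equivalence.\<close>

definition is_congruence :: "('o, 'm) cat \<Rightarrow> ('m \<times> 'm) set \<Rightarrow> bool" where
  "is_congruence C r \<longleftrightarrow> equiv (Mor C) r \<and>
     (\<forall>f g. (f, g) \<in> r \<longrightarrow> Dom C f = Dom C g \<and> Cod C f = Cod C g) \<and>
     (\<forall>f f' g g'. (f, f') \<in> r \<and> (g, g') \<in> r \<and> Cod C f = Dom C g \<longrightarrow>
        (Cmp C g f, Cmp C g' f') \<in> r)"

lemma
  assumes r: "is_congruence C r"
  shows congruence_equiv: "equiv (Mor C) r"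
    and congruence_Dom: "(f, g) \<in> r \<Longrightarrow> Dom C f = Dom C g"
    and congruence_Cod: "(f, g) \<in> r \<Longrightarrow> Cod C f = Cod C g"
    and congruence_Cmp: "\<lbrakk>(f, f') \<in> r; (g, g') \<in> r; Cod C f = Dom C g\<rbrakk> \<Longrightarrow>
      (Cmp C g f, Cmp C g' f') \<in> r"
  using r unfolding is_congruence_def by blast+

lemma quot_cat_Obj [simp]: "Obj (quot_cat C r) = Obj C"
  and quot_cat_Mor [simp]: "Mor (quot_cat C r) = Mor C // r"
  and quot_cat_Ide [simp]: "Ide (quot_cat C r) x = r `` {Ide C x}"
  by (simp_all add: quot_cat_def)

lemma
  assumes r: "is_congruence C r" and f: "f \<in> Mor C"
  shows quot_cat_Dom: "Dom (quot_cat C r) (r `` {f}) = Dom C f"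
    and quot_cat_Cod: "Cod (quot_cat C r) (r `` {f}) = Cod C f"
proof -
  have "f \<in> r `` {f}"
    using f congruence_equiv[OF r] by (meson equiv_class_self)
  moreover have "Dom C ` (r `` {f}) = (\<lambda>_. Dom C f) ` (r `` {f})"
    "Cod C ` (r `` {f}) = (\<lambda>_. Cod C f) ` (r `` {f})"
    by (rule image_cong[OF HOL.refl]; use congruence_Dom[OF r, of f] congruence_Cod[OF r, of f] in force)+
  ultimately have "Dom C ` (r `` {f}) = {Dom C f}" "Cod C ` (r `` {f}) = {Cod C f}"
    by auto
  then show "Dom (quot_cat C r) (r `` {f}) = Dom C f" "Cod (quot_cat C r) (r `` {f}) = Cod C f"
    by (simp_all add: quot_cat_def)
qed

lemma quot_cat_Cmp:
  assumes r: "is_congruence C r" and fg: "f \<in> Mor C" "g \<in> Mor C" "Cod C f = Dom C g"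
  shows "Cmp (quot_cat C r) (r `` {g}) (r `` {f}) = r `` {Cmp C g f}"
proof -
  note eqv = congruence_equiv[OF r]
  have "r `` {Cmp C g' f'} = r `` {Cmp C g f}" if "g' \<in> r `` {g}" "f' \<in> r `` {f}" for f' g'
    using equiv_class_eq[OF eqv congruence_Cmp[OF r, of f f' g g']] that fg by simp
  moreover have "f \<in> r `` {f}" "g \<in> r `` {g}"
    using fg eqv by (meson equiv_class_self)+
  ultimately have "(\<Union>g'\<in>r `` {g}. \<Union>f'\<in>r `` {f}. r `` {Cmp C g' f'}) = r `` {Cmp C g f}"
    by blast
  then show ?thesis
    by (simp add: quot_cat_def)
qed

lemma is_category_quot_cat:
  assumes C: "is_category C" and r: "is_congruence C r"
  shows "is_category (quot_cat C r)"
proof -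
  note [simp] = quot_cat_Dom[OF r] quot_cat_Cod[OF r] quot_cat_Cmp[OF r] category_simps[OF C]
    quotientI
  show ?thesis
    unfolding is_category_def by (auto elim!: quotientE)
qed

text \<open>The rule \<open>comp\<close> asks only the unprimed factors to be composable; the primed
  ones are so because the induction keeps related morphisms parallel.\<close>

lemma is_congruence_cong_closure:
  assumes C: "is_category C"
    and R: "\<And>f g. (f, g) \<in> R \<Longrightarrow> f \<in> Mor C \<and> g \<in> Mor C \<and> Dom C f = Dom C g \<and> Cod C f = Cod C g"
  shows "is_congruence C (cong_closure C R)"
proof -
  have *: "f \<in> Mor C \<and> g \<in> Mor C \<and> Dom C f = Dom C g \<and> Cod C f = Cod C g"
    if "(f, g) \<in> cong_closure C R" for f g
    using that by induction (auto simp: R category_simps[OF C])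
  have "equiv (Mor C) (cong_closure C R)"
    using * by (auto intro!: equivI refl_onI symI transI intro: cong_closure.intros)
  then show ?thesis
    unfolding is_congruence_def using * by (blast intro: cong_closure.comp)
qed

lemma is_congruence_functor_kernel:
  assumes C: "is_category C" and F: "is_functor C D F"
  shows "is_congruence C (functor_kernel C F)"
proof -
  have "equiv (Mor C) (functor_kernel C F)"
    unfolding functor_kernel_def by (auto intro!: equivI refl_onI symI transI)
  then show ?thesis
    unfolding is_congruence_def functor_kernel_def
    by (auto simp: Fmo_Cmp[OF F] category_simps[OF C])
qed

section \<open>Free categories on quivers and the functors out of them\<close>

lemma free_cat_simps [simp]:
  "Obj (free_cat Q) = Vert Q" "(x, w, y) \<in> Mor (free_cat Q) \<longleftrightarrow> quiver_walk Q x w y"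
  "Dom (free_cat Q) f = fst f" "Cod (free_cat Q) f = snd (snd f)"
  "Ide (free_cat Q) x = (x, [], x)"
  "Cmp (free_cat Q) g f = (fst f, fst (snd f) @ fst (snd g), snd (snd g))"
  by (simp_all add: free_cat_def)

lemma quiver_walk_Nil_iff [simp]: "quiver_walk Q x [] y \<longleftrightarrow> x = y \<and> x \<in> Vert Q"
  by (auto intro: quiver_walk.Nil elim: quiver_walk.cases)

lemma quiver_walk_Cons_iff [simp]:
  "quiver_walk Q x (a # w) y \<longleftrightarrow>
    x = Src Q a \<and> a \<in> Arr Q \<and> Src Q a \<in> Vert Q \<and> quiver_walk Q (Tgt Q a) w y"
  by (auto intro: quiver_walk.Cons elim: quiver_walk.cases)

lemma quiver_walk_ends: "quiver_walk Q x w y \<Longrightarrow> x \<in> Vert Q \<and> y \<in> Vert Q"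
  by (induction rule: quiver_walk.induct) auto

lemma quiver_walk_append:
  "quiver_walk Q x v y \<Longrightarrow> quiver_walk Q y w z \<Longrightarrow> quiver_walk Q x (v @ w) z"
  by (induction rule: quiver_walk.induct) auto

lemma is_category_free_cat: "is_category (free_cat Q)"
  unfolding is_category_def using quiver_walk_ends quiver_walk_append by fastforce

lemma is_functor_free_functor:
  assumes D: "is_category D" and v: "\<And>x. x \<in> Vert Q \<Longrightarrow> v x \<in> Obj D"
    and m: "\<And>a. a \<in> Arr Q \<Longrightarrow> m a \<in> Mor D \<and> Dom D (m a) = v (Src Q a) \<and> Cod D (m a) = v (Tgt Q a)"
  shows "is_functor (free_cat Q) D (free_functor Q D v m)"
proof -
  have val: "walk_value Q D v m x w \<in> Mor D \<and> Dom D (walk_value Q D v m x w) = v x \<and>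
      Cod D (walk_value Q D v m x w) = v y" if "quiver_walk Q x w y" for x w y
    using that by induction (auto simp: v m category_simps[OF D])
  have app: "walk_value Q D v m x (w @ w') = Cmp D (walk_value Q D v m y w') (walk_value Q D v m x w)"
    if "quiver_walk Q x w y" "quiver_walk Q y w' z" for x w y w' z
    using that
  proof (induction rule: quiver_walk.induct)
    case (Nil x)
    then show ?case using val by (simp add: category_simps[OF D])
  next
    case (Cons a w y)
    then show ?case
      using val[OF Cons.hyps(3)] val[OF Cons.prems] m[of a] by (simp add: category_simps[OF D])
  qed
  show ?thesis
    unfolding is_functor_def free_functor_def using v val app by fastforce
qed

section \<open>Localization of a cancellative category\<close>

text \<open>Abstracts the path category with the classes of paths inside pixels. The cancellation
  axiom of a calculus of right fractions is contained in \<open>mono\<close>, with an identity as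
  the equalizing element of \<open>S\<close>. The role of \<open>epi\<close> is to compare values of
  zigzags after they have been refined by an element of \<open>S\<close>.\<close>

locale cancellative_ore =
  fixes C :: "('o, 'm) cat" and S :: "'m set"
  assumes category: "is_category C"
    and S_subset: "S \<subseteq> Mor C"
    and S_Ide: "x \<in> Obj C \<Longrightarrow> Ide C x \<in> S"
    and S_Cmp: "\<lbrakk>s \<in> S; t \<in> S; Cod C s = Dom C t\<rbrakk> \<Longrightarrow> Cmp C t s \<in> S"
    and right_ore: "\<lbrakk>s \<in> S; f \<in> Mor C; Cod C s = Cod C f\<rbrakk> \<Longrightarrow>
      \<exists>t\<in>S. \<exists>g\<in>Mor C. Cod C t = Dom C f \<and> Cod C g = Dom C s \<and> Dom C g = Dom C t \<and>
        Cmp C s g = Cmp C f t"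
    and mono: "\<lbrakk>f \<in> Mor C; g \<in> Mor C; h \<in> Mor C; Cod C f = Dom C h; Cod C g = Dom C h;
      Cmp C h f = Cmp C h g\<rbrakk> \<Longrightarrow> f = g"
    and epi: "\<lbrakk>f \<in> Mor C; g \<in> Mor C; h \<in> Mor C; Cod C h = Dom C f; Cod C h = Dom C g;
      Cmp C f h = Cmp C g h\<rbrakk> \<Longrightarrow> f = g"
begin

abbreviation "Q \<equiv> zigzag_quiver C S"
abbreviation "L \<equiv> localization C S"
abbreviation "p \<equiv> Fmo (loc_functor C S)"

lemmas C_simps = category_simps[OF category]

lemma S_in_Mor: "s \<in> S \<Longrightarrow> s \<in> Mor C"
  using S_subset by blast

lemma Q_simps [simp]:
  "Vert Q = Obj C" "Src Q (Fwd f) = Dom C f" "Tgt Q (Fwd f) = Cod C f"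
  "Src Q (Bwd f) = Cod C f" "Tgt Q (Bwd f) = Dom C f"
  "Fwd f \<in> Arr Q \<longleftrightarrow> f \<in> Mor C" "Bwd f \<in> Arr Q \<longleftrightarrow> f \<in> S"
  by (auto simp: zigzag_quiver_def)

lemma congruence: "is_congruence (free_cat Q) (loc_cong C S)"
  unfolding loc_cong_def
  by (rule is_congruence_cong_closure[OF is_category_free_cat])
    (auto simp: loc_relations_def S_in_Mor C_simps)

lemma L_category: "is_category L"
  unfolding localization_def by (rule is_category_quot_cat[OF is_category_free_cat congruence])

lemmas L_simps = category_simps[OF L_category]

lemmas loc_cong_refl = cong_closure.refl[of _ "free_cat Q" "loc_relations C S", folded loc_cong_def]
lemmas loc_cong_sym = cong_closure.sym[of _ _ "free_cat Q" "loc_relations C S", folded loc_cong_def]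
lemmas loc_cong_trans [trans] =
  cong_closure.trans[of _ _ "free_cat Q" "loc_relations C S", folded loc_cong_def]

lemma loc_cong_append:
  assumes "((x, v, y), (x, v', y)) \<in> loc_cong C S" "((y, w, z), (y, w', z)) \<in> loc_cong C S"
  shows "((x, v @ w, z), (x, v' @ w', z)) \<in> loc_cong C S"
  using congruence_Cmp[OF congruence assms] by simp

lemma loc_cong_append_left:
  "\<lbrakk>((x, v, y), (x, v', y)) \<in> loc_cong C S; quiver_walk Q y w z\<rbrakk> \<Longrightarrow>
    ((x, v @ w, z), (x, v' @ w, z)) \<in> loc_cong C S"
  by (rule loc_cong_append) (auto intro: loc_cong_refl)

lemma loc_cong_append_right:
  "\<lbrakk>quiver_walk Q x v y; ((y, w, z), (y, w', z)) \<in> loc_cong C S\<rbrakk> \<Longrightarrow>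
    ((x, v @ w, z), (x, v @ w', z)) \<in> loc_cong C S"
  by (rule loc_cong_append) (auto intro: loc_cong_refl)

lemma loc_cong_relations:
  "x \<in> Obj C \<Longrightarrow> ((x, [Fwd (Ide C x)], x), (x, [], x)) \<in> loc_cong C S"
  "\<lbrakk>f \<in> Mor C; g \<in> Mor C; Cod C f = Dom C g\<rbrakk> \<Longrightarrow>
    ((Dom C f, [Fwd f, Fwd g], Cod C g), (Dom C f, [Fwd (Cmp C g f)], Cod C g)) \<in> loc_cong C S"
  "s \<in> S \<Longrightarrow> ((Dom C s, [Fwd s, Bwd s], Dom C s), (Dom C s, [], Dom C s)) \<in> loc_cong C S"
  "s \<in> S \<Longrightarrow> ((Cod C s, [Bwd s, Fwd s], Cod C s), (Cod C s, [], Cod C s)) \<in> loc_cong C S"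
  unfolding loc_cong_def by (rule cong_closure.base; auto simp: loc_relations_def)+

abbreviation zig_class :: "'o \<Rightarrow> 'm zig list \<Rightarrow> 'o \<Rightarrow> ('o \<times> 'm zig list \<times> 'o) set" where
  "zig_class x w y \<equiv> loc_cong C S `` {(x, w, y)}"

lemma L_Obj [simp]: "Obj L = Obj C"
  by (simp add: localization_def)

lemma L_Ide: "Ide L x = zig_class x [] x"
  by (simp add: localization_def)

lemma zig_class:
  assumes "quiver_walk Q x w y"
  shows "zig_class x w y \<in> Mor L" "Dom L (zig_class x w y) = x" "Cod L (zig_class x w y) = y"
  using assms quot_cat_Dom[OF congruence, of "(x, w, y)"] quot_cat_Cod[OF congruence, of "(x, w, y)"]
  by (simp_all add: localization_def quotientI)

lemma zig_class_Cmp: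
  assumes "quiver_walk Q x v y" "quiver_walk Q y w z"
  shows "Cmp L (zig_class y w z) (zig_class x v y) = zig_class x (v @ w) z"
  using assms quot_cat_Cmp[OF congruence, of "(x, v, y)" "(y, w, z)"]
  by (simp add: localization_def)

lemma zig_class_eq: "((x, v, y), (x, w, y)) \<in> loc_cong C S \<Longrightarrow> zig_class x v y = zig_class x w y"
  by (rule equiv_class_eq[OF congruence_equiv[OF congruence]])

lemma Mor_L_cases:
  assumes "\<alpha> \<in> Mor L"
  obtains w where "quiver_walk Q (Dom L \<alpha>) w (Cod L \<alpha>)" "\<alpha> = zig_class (Dom L \<alpha>) w (Cod L \<alpha>)"
proof -
  obtain f where "f \<in> Mor (free_cat Q)" "\<alpha> = loc_cong C S `` {f}"
    using assms by (auto simp: localization_def elim: quotientE)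
  then show thesis
    using that zig_class by (cases f) auto
qed

lemma loc_functor_simps [simp]:
  "Fob (loc_functor C S) x = x" "p f = zig_class (Dom C f) [Fwd f] (Cod C f)"
  by (simp_all add: loc_functor_def free_arrow_def)

lemma loc_functor: "is_functor C L (loc_functor C S)"
  unfolding is_functor_def
  using zig_class zig_class_Cmp loc_cong_relations[THEN zig_class_eq]
  by (simp add: C_simps L_Ide)

lemma loc_inverse_eq: "loc_inverse C S s = zig_class (Cod C s) [Bwd s] (Dom C s)"
  by (simp add: loc_inverse_def free_arrow_def)

lemma loc_inverse:
  assumes "s \<in> S"
  shows "loc_inverse C S s \<in> Mor L" "Dom L (loc_inverse C S s) = Cod C s"
    "Cod L (loc_inverse C S s) = Dom C s"
    "Cmp L (loc_inverse C S s) (p s) = Ide L (Dom C s)"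
    "Cmp L (p s) (loc_inverse C S s) = Ide L (Cod C s)"
  unfolding loc_inverse_eq
  using assms zig_class zig_class_Cmp loc_cong_relations(3,4)[THEN zig_class_eq]
  by (simp_all add: C_simps S_in_Mor L_Ide)

lemma loc_functor_iso: "s \<in> S \<Longrightarrow> is_iso L (p s)"
  unfolding is_iso_def using loc_inverse[of s] S_in_Mor[of s] Fmo_in_Mor[OF loc_functor, of s]
    Dom_Fmo[OF loc_functor, of s] Cod_Fmo[OF loc_functor, of s]
  by (intro conjI bexI[of _ "loc_inverse C S s"]) (simp_all del: loc_functor_simps(2))

text \<open>\<open>zig_cone w h k\<close>: the zigzag \<open>w\<close> has a cone, in \<open>C\<close> itself, with first leg \<open>h\<close> and last leg \<open>k\<close>.
  As \<open>C\<close> is cancellative, \<open>w\<close> acts in this way as a partial function on morphisms into its source,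
  and by the Ore condition every morphism enters its domain after composition with some element of
  \<open>S\<close>. Congruent zigzags agree wherever both are defined; this avoids constructing the category of
  fractions.\<close>

primrec zig_cone :: "'m zig list \<Rightarrow> 'm \<Rightarrow> 'm \<Rightarrow> bool" where
  "zig_cone [] h k \<longleftrightarrow> h = k"
| "zig_cone (a # w) h k \<longleftrightarrow> (case a of
      Fwd f \<Rightarrow> zig_cone w (Cmp C f h) k
    | Bwd s \<Rightarrow> \<exists>l\<in>Mor C. Cod C l = Dom C s \<and> Cmp C s l = h \<and> zig_cone w l k)"

lemma zig_cone_append: "zig_cone (v @ w) h k \<longleftrightarrow> (\<exists>l. zig_cone v h l \<and> zig_cone w l k)"
  by (induction v arbitrary: h) (auto split: zig.splits)

lemma zig_cone_in_Mor:
  "\<lbrakk>zig_cone w h k; quiver_walk Q x w y; h \<in> Mor C; Cod C h = x\<rbrakk> \<Longrightarrow>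
    k \<in> Mor C \<and> Dom C k = Dom C h \<and> Cod C k = y"
proof (induction w arbitrary: h x)
  case (Cons a w)
  then show ?case by (cases a) (fastforce simp: C_simps S_in_Mor)+
qed simp

text \<open>The only choice in a cone is the quotient \<open>l\<close> of \<open>h\<close> by
  \<open>s\<close> at a letter \<open>Bwd s\<close>, and \<open>mono\<close> makes it
  unique.\<close>

lemma zig_cone_unique:
  "\<lbrakk>zig_cone w h k; zig_cone w h k'; quiver_walk Q x w y; h \<in> Mor C; Cod C h = x\<rbrakk> \<Longrightarrow> k = k'"
proof (induction w arbitrary: h x)
  case (Cons a w)
  show ?case
  proof (cases a)
    case (Fwd f)
    with Cons show ?thesis by (auto simp: C_simps)
  next
    case (Bwd s)
    with Cons.prems obtain l l' where l: "l \<in> Mor C" "Cod C l = Dom C s" "Cmp C s l = h" "zig_cone w l k"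
      "l' \<in> Mor C" "Cod C l' = Dom C s" "Cmp C s l' = h" "zig_cone w l' k'" by auto
    have "l = l'"
      using mono[of l l' s] l Cons.prems(3) Bwd S_in_Mor by auto
    with l Cons.IH[of l "Dom C s"] Cons.prems(3) Bwd show ?thesis by auto
  qed
qed simp

text \<open>All legs of the cone may be precomposed with \<open>u\<close>: if \<open>l\<close> is
  the quotient of \<open>h\<close> by \<open>s\<close>, then \<open>Cmp C l u\<close> is that of
  \<open>Cmp C h u\<close>.\<close>

lemma zig_cone_precomp:
  "\<lbrakk>zig_cone w h k; quiver_walk Q x w y; h \<in> Mor C; Cod C h = x; u \<in> Mor C; Cod C u = Dom C h\<rbrakk> \<Longrightarrow>
    zig_cone w (Cmp C h u) (Cmp C k u)"
proof (induction w arbitrary: h x)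
  case (Cons a w)
  show ?case
  proof (cases a)
    case (Fwd f)
    with Cons.prems Cons.IH[of "Cmp C f h" "Cod C f"] show ?thesis by (simp add: C_simps)
  next
    case (Bwd s)
    with Cons.prems obtain l where l: "l \<in> Mor C" "Cod C l = Dom C s" "Cmp C s l = h" "zig_cone w l k"
      by auto
    have s: "s \<in> Mor C"
      using Cons.prems(2) Bwd S_in_Mor by simp
    have "Dom C l = Dom C h"
      using l s by (auto simp: C_simps)
    then have "zig_cone w (Cmp C l u) (Cmp C k u)"
      using Cons.IH[of l "Dom C s"] l Cons.prems Bwd by simp
    moreover have "Cmp C s (Cmp C l u) = Cmp C h u"
      using Cmp_assoc[OF category, of u l s] l s Cons.prems \<open>Dom C l = Dom C h\<close> by simp
    ultimately show ?thesis
      using Bwd l Cons.prems \<open>Dom C l = Dom C h\<close>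
      by (auto simp: C_simps intro!: bexI[of _ "Cmp C l u"])
  qed
qed simp

text \<open>At a letter \<open>Bwd s\<close> the Ore condition makes \<open>h\<close> divisible by
  \<open>s\<close> after refinement by some \<open>t\<close> in \<open>S\<close>. The rest of the
  zigzag may demand a further refinement \<open>u\<close>, and the two multiply inside
  \<open>S\<close>.\<close>

lemma zig_cone_exists:
  "\<lbrakk>quiver_walk Q x w y; h \<in> Mor C; Cod C h = x\<rbrakk> \<Longrightarrow>
    \<exists>u\<in>S. Cod C u = Dom C h \<and> (\<exists>k. zig_cone w (Cmp C h u) k)"
proof (induction w arbitrary: h x)
  case Nil
  then show ?case by (intro bexI[of _ "Ide C (Dom C h)"]) (simp_all add: C_simps S_Ide)
next
  case (Cons a w)
  show ?case
  proof (cases a)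
    case (Fwd f)
    with Cons.prems Cons.IH[of "Cod C f" "Cmp C f h"] show ?thesis
      by (fastforce simp: C_simps S_in_Mor)
  next
    case (Bwd s)
    then have s: "s \<in> S" "Cod C s = Cod C h" "quiver_walk Q (Dom C s) w y"
      using Cons.prems by auto
    obtain t g where tg: "t \<in> S" "g \<in> Mor C" "Cod C t = Dom C h" "Cod C g = Dom C s"
      "Dom C g = Dom C t" "Cmp C s g = Cmp C h t"
      using right_ore[OF s(1) Cons.prems(2) s(2)] by blast
    obtain u k where u: "u \<in> S" "Cod C u = Dom C g" "zig_cone w (Cmp C g u) k"
      using Cons.IH[OF s(3) tg(2,4)] by blast
    have "Cmp C s (Cmp C g u) = Cmp C h (Cmp C t u)"
      using Cmp_assoc[OF category, of u g s] Cmp_assoc[OF category, of u t h] tg u s Cons.prems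
      by (simp add: S_in_Mor)
    then have "zig_cone (a # w) (Cmp C h (Cmp C t u)) k"
      using Bwd u tg by (auto simp: C_simps S_in_Mor intro!: bexI[of _ "Cmp C g u"])
    moreover have "Cmp C t u \<in> S" "Cod C (Cmp C t u) = Dom C h"
      using S_Cmp[of u t] u tg by (simp_all add: C_simps S_in_Mor)
    ultimately show ?thesis by blast
  qed
qed

text \<open>Induction on the derivation of the congruence. Among the generating relations only the
  one cancelling \<open>[Fwd s, Bwd s]\<close> needs \<open>mono\<close>. Transitivity is the hard
  case, since the intermediate zigzag may have no cone with first leg \<open>h\<close>.\<close>

lemma loc_cong_imp_zig_cone_eq:
  "\<lbrakk>(v, w) \<in> loc_cong C S; h \<in> Mor C; Cod C h = fst v;
    zig_cone (fst (snd v)) h k; zig_cone (fst (snd w)) h k'\<rbrakk> \<Longrightarrow> k = k'"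
  unfolding loc_cong_def
proof (induction arbitrary: h k k' rule: cong_closure.induct)
  case (base f g)
  then show ?case
    using mono by (auto simp: loc_relations_def C_simps S_in_Mor) (blast dest: S_in_Mor)+
next
  case (refl f)
  then show ?case by (cases f) (auto intro: zig_cone_unique)
next
  case (sym f g)
  then show ?case
    using congruence_Dom[OF congruence, of f g] by (auto simp: loc_cong_def)
next
  case (trans f g e)
  have fge: "(f, g) \<in> loc_cong C S" "(g, e) \<in> loc_cong C S"
    using trans.hyps by (simp_all add: loc_cong_def)
  have Mor: "quiver_walk Q (fst m) (fst (snd m)) (snd (snd m))" if "m = f \<or> m = g \<or> m = e" for m
    using fge that equiv_type[OF congruence_equiv[OF congruence]]
    by (cases m) auto
  have fst: "fst g = fst f" "fst e = fst f"
    using fge[THEN congruence_Dom[OF congruence]] by auto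
  \<comment> \<open>Refining \<open>h\<close> by \<open>u\<close> brings it into the domain of the
    intermediate zigzag without leaving the domains of the outer two; \<open>epi\<close> removes
    \<open>u\<close> at the end.\<close>
  obtain u l where u: "u \<in> S" "Cod C u = Dom C h" "zig_cone (fst (snd g)) (Cmp C h u) l"
    using zig_cone_exists[OF Mor[of g], of h] trans.prems fst by auto
  have k: "k \<in> Mor C" "Dom C k = Dom C h" "k' \<in> Mor C" "Dom C k' = Dom C h"
    using zig_cone_in_Mor[OF trans.prems(3) Mor[of f]] zig_cone_in_Mor[OF trans.prems(4) Mor[of e]]
      trans.prems fst by auto
  have "zig_cone (fst (snd f)) (Cmp C h u) (Cmp C k u)" "zig_cone (fst (snd e)) (Cmp C h u) (Cmp C k' u)"
    using zig_cone_precomp[OF trans.prems(3) Mor[of f]] zig_cone_precomp[OF trans.prems(4) Mor[of e]]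
      trans.prems fst u by (auto simp: S_in_Mor)
  moreover have "Cmp C h u \<in> Mor C" "Cod C (Cmp C h u) = fst f"
    using u trans.prems by (simp_all add: C_simps S_in_Mor)
  ultimately have "Cmp C k u = l" "l = Cmp C k' u"
    using trans.IH u fst by metis+
  then show ?case
    using epi[of k k' u] k u by (simp add: S_in_Mor)
next
  case (comp f f' g g')
  have ff': "(f, f') \<in> loc_cong C S"
    using comp.hyps by (simp add: loc_cong_def)
  have walk: "quiver_walk Q (fst f) (fst (snd f)) (snd (snd f))"
    using ff' equiv_type[OF congruence_equiv[OF congruence]] by (cases f) auto
  \<comment> \<open>Concatenation of zigzags is composition of partial maps, so the cones split at
    the middle vertex.\<close>
  obtain l l' where l: "zig_cone (fst (snd f)) h l" "zig_cone (fst (snd g)) l k"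
    "zig_cone (fst (snd f')) h l'" "zig_cone (fst (snd g')) l' k'"
    using comp.prems by (auto simp: zig_cone_append)
  have "l = l'"
    using comp.IH(1)[OF _ _ l(1,3)] comp.prems by simp
  moreover have "l \<in> Mor C" "Cod C l = fst g"
    using zig_cone_in_Mor[OF l(1) walk] comp.prems comp.hyps by auto
  ultimately show ?case
    using comp.IH(2) l by blast
qed

lemma loc_functor_faithful: "faithful C (loc_functor C S)"
  unfolding faithful_def
proof (intro ballI impI; elim conjE)
  fix f g assume fg: "f \<in> Mor C" "g \<in> Mor C" "Dom C f = Dom C g" "Cod C f = Cod C g" "p f = p g"
  then have "((Dom C f, [Fwd f], Cod C f), (Dom C f, [Fwd g], Cod C f)) \<in> loc_cong C S"
    using eq_equiv_class[OF _ congruence_equiv[OF congruence]] by (simp add: C_simps)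
  \<comment> \<open>At the identity both one-letter zigzags are defined, with values
    \<open>f\<close> and \<open>g\<close>.\<close>
  from loc_cong_imp_zig_cone_eq[OF this, of "Ide C (Dom C f)" f g] fg
  show "f = g" by (simp add: C_simps)
qed

text \<open>Conversely, a cone is a recipe for shortening: forward letters are absorbed by
  composition, and at \<open>Bwd s\<close> the leg \<open>h\<close> factors through
  \<open>s\<close>, which then cancels.\<close>

lemma zig_cone_loc_cong:
  "\<lbrakk>zig_cone w h k; quiver_walk Q x w y; h \<in> Mor C; Cod C h = x\<rbrakk> \<Longrightarrow>
    ((Dom C h, Fwd h # w, y), (Dom C h, [Fwd k], y)) \<in> loc_cong C S"
proof (induction w arbitrary: h x)
  case Nil
  then show ?case by (auto simp: C_simps intro!: loc_cong_refl)
next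
  case (Cons a w)
  show ?case
  proof (cases a)
    case (Fwd f)
    then have f: "f \<in> Mor C" "Cod C h = Dom C f" "quiver_walk Q (Cod C f) w y"
      using Cons.prems by auto
    have "((Dom C h, [Fwd h, Fwd f] @ w, y), (Dom C h, [Fwd (Cmp C f h)] @ w, y)) \<in> loc_cong C S"
      using loc_cong_append_left[OF loc_cong_relations(2)] Cons.prems f by blast
    also have "((Dom C h, [Fwd (Cmp C f h)] @ w, y), (Dom C h, [Fwd k], y)) \<in> loc_cong C S"
      using Cons.IH[of "Cmp C f h" "Cod C f"] Cons.prems f Fwd by (simp add: C_simps)
    finally show ?thesis using Fwd by simp
  next
    case (Bwd s)
    then have s: "s \<in> S" "quiver_walk Q (Dom C s) w y"
      using Cons.prems by auto
    obtain l where l: "l \<in> Mor C" "Cod C l = Dom C s" "Cmp C s l = h" "zig_cone w l k"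
      using Cons.prems Bwd by auto
    have h: "Dom C h = Dom C l" "Cod C h = Cod C s"
      using l s by (auto simp: C_simps S_in_Mor)
    have walk: "quiver_walk Q (Cod C s) (Bwd s # w) y"
      using s by (simp add: C_simps S_in_Mor)
    \<comment> \<open>Splits \<open>h\<close> into \<open>l\<close> and \<open>s\<close>, so that
      \<open>Fwd s\<close> comes to stand next to \<open>Bwd s\<close>.\<close>
    have "((Dom C l, [Fwd h], Cod C s), (Dom C l, [Fwd l, Fwd s], Cod C s)) \<in> loc_cong C S"
      using loc_cong_sym[OF loc_cong_relations(2)[of l s]] l s by (simp add: S_in_Mor)
    from loc_cong_append_left[OF this walk]
    have "((Dom C l, Fwd h # Bwd s # w, y), (Dom C l, [Fwd l] @ [Fwd s, Bwd s] @ w, y)) \<in> loc_cong C S"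
      by simp
    also have "((Dom C l, [Fwd l] @ [Fwd s, Bwd s] @ w, y), (Dom C l, [Fwd l] @ [] @ w, y)) \<in> loc_cong C S"
      using l s by (intro loc_cong_append_right[of _ _ "Dom C s"]
          loc_cong_append_left[of _ _ "Dom C s"] loc_cong_relations) (auto simp: C_simps S_in_Mor)
    also have "((Dom C l, [Fwd l] @ [] @ w, y), (Dom C l, [Fwd k], y)) \<in> loc_cong C S"
      using Cons.IH[of l "Dom C s"] l s by simp
    finally show ?thesis
      using Bwd h by simp
  qed
qed

text \<open>Every morphism of the localization has the form \<open>p k\<close> after the inverse of
  \<open>p u\<close>: a representing zigzag, evaluated at a refinement \<open>u\<close> of the
  identity, has some value \<open>k\<close>.\<close>

lemma right_fraction:
  assumes \<alpha>: "\<alpha> \<in> Mor L"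
  shows "\<exists>u\<in>S. \<exists>k\<in>Mor C. Cod C u = Dom L \<alpha> \<and> Dom C k = Dom C u \<and> Cod C k = Cod L \<alpha> \<and>
    Cmp L \<alpha> (p u) = p k"
proof -
  obtain w where w: "quiver_walk Q (Dom L \<alpha>) w (Cod L \<alpha>)" "\<alpha> = zig_class (Dom L \<alpha>) w (Cod L \<alpha>)"
    using \<alpha> by (rule Mor_L_cases)
  let ?i = "Ide C (Dom L \<alpha>)"
  have x: "Dom L \<alpha> \<in> Obj C"
    using quiver_walk_ends[OF w(1)] by simp
  obtain u k where u: "u \<in> S" "Cod C u = Dom L \<alpha>" "zig_cone w (Cmp C ?i u) k"
    using zig_cone_exists[OF w(1), of ?i] x by (auto simp: C_simps)
  then have cone: "zig_cone w u k"
    by (simp add: C_simps S_in_Mor)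
  have k: "k \<in> Mor C" "Dom C k = Dom C u" "Cod C k = Cod L \<alpha>"
    using zig_cone_in_Mor[OF cone w(1)] u by (auto simp: S_in_Mor)
  have "Cmp L (zig_class (Dom L \<alpha>) w (Cod L \<alpha>)) (p u) = p k"
    using zig_class_eq[OF zig_cone_loc_cong[OF cone w(1)]] u k w x
      zig_class_Cmp[of "Dom C u" "[Fwd u]" "Dom L \<alpha>" w "Cod L \<alpha>"]
    by (simp add: S_in_Mor C_simps)
  then have "Cmp L \<alpha> (p u) = p k"
    unfolding w(2)[symmetric] .
  then show ?thesis
    using u(1,2) k by blast
qed

text \<open>A common denominator: \<open>u\<close> serves \<alpha>, then a denominator
  \<open>v\<close> is taken for \<beta> already composed with \<open>p u\<close>, so that
  \<open>Cmp C u v\<close> serves both.\<close>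

lemma loc_functor_lifts_spans: "lifts_spans C L (loc_functor C S)"
  unfolding lifts_spans_def
proof (intro ballI impI; elim conjE)
  fix a b \<alpha> \<beta>
  assume \<alpha>\<beta>: "\<alpha> \<in> Mor L" "\<beta> \<in> Mor L" "Dom L \<alpha> = Dom L \<beta>"
    "Cod L \<alpha> = Fob (loc_functor C S) a" "Cod L \<beta> = Fob (loc_functor C S) b"
  note [simp del] = loc_functor_simps(2)
  note Fs = functor_simps[OF loc_functor]
  obtain u k where u: "u \<in> S" "k \<in> Mor C" "Cod C u = Dom L \<alpha>" "Dom C k = Dom C u"
    "Cod C k = Cod L \<alpha>" "Cmp L \<alpha> (p u) = p k"
    using right_fraction[OF \<alpha>\<beta>(1)] by blast
  have \<beta>u: "Cmp L \<beta> (p u) \<in> Mor L" "Dom L (Cmp L \<beta> (p u)) = Dom C u"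
    "Cod L (Cmp L \<beta> (p u)) = Cod L \<beta>"
    using u \<alpha>\<beta> by (simp_all add: L_simps Fs S_in_Mor)
  obtain v l where v: "v \<in> S" "l \<in> Mor C" "Cod C v = Dom C u" "Dom C l = Dom C v"
    "Cod C l = Cod L \<beta>" "Cmp L (Cmp L \<beta> (p u)) (p v) = p l"
    using right_fraction[OF \<beta>u(1)] \<beta>u by auto
  have uv: "Cmp C u v \<in> S" "p (Cmp C u v) = Cmp L (p u) (p v)"
    using u v S_Cmp Fmo_Cmp[OF loc_functor, of v u] by (auto simp: S_in_Mor)
  have "Cmp L \<alpha> (p (Cmp C u v)) = p (Cmp C k v)"
    using u v \<alpha>\<beta> uv Cmp_assoc[OF L_category, of "p v" "p u" \<alpha>] Fmo_Cmp[OF loc_functor, of v k]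
    by (simp add: Fs S_in_Mor)
  moreover have "Cmp L \<beta> (p (Cmp C u v)) = p l"
    using u v \<alpha>\<beta> uv Cmp_assoc[OF L_category, of "p v" "p u" \<beta>]
    by (simp add: Fs S_in_Mor)
  ultimately show "\<exists>z\<in>Obj C. \<exists>u. \<exists>k\<in>Mor C. \<exists>l\<in>Mor C. is_iso L u \<and>
    Dom L u = Fob (loc_functor C S) z \<and> Cod L u = Dom L \<alpha> \<and>
    Dom C k = z \<and> Cod C k = a \<and> Dom C l = z \<and> Cod C l = b \<and>
    Cmp L \<alpha> u = p k \<and> Cmp L \<beta> u = p l"
    using u(1-5) v(1-5) \<alpha>\<beta> loc_functor_iso[OF uv(1)]
    by - (rule bexI[of _ "Dom C v"], rule exI[of _ "p (Cmp C u v)"], rule bexI[of _ "Cmp C k v"],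
        rule bexI[of _ l], simp_all add: Fs C_simps S_in_Mor)
qed

end

section \<open>The path category\<close>

text \<open>Intervals of reals are the connected sets, and continuous images preserve
  connectedness.\<close>

lemma path_reparamI:
  assumes "\<phi> \<in> {0..1} \<rightarrow> {0..1}" "mono_on {0..1} \<phi>" "continuous_on {0..1} \<phi>"
  shows "path_reparam \<phi>"
  using assms connected_continuous_image continuous_on_subset
  unfolding path_reparam_def is_interval_connected_1 by blast

lemma path_concat_ends [simp]:
  "path_concat \<gamma> \<delta> 0 = \<gamma> 0" "path_concat \<gamma> \<delta> 1 = \<delta> 1"
  by (simp_all add: path_concat_def)

lemma path_const_apply [simp]: "t \<in> {0..1} \<Longrightarrow> path_const x t = x"
  by (simp add: path_const_def)

lemma path_const_ends [simp]: "path_const x 0 = x" "path_const x 1 = x"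
  by simp_all

lemma path_im_const [simp]: "path_im (path_const x) = {x}"
  by (simp add: path_im_def path_const_def image_constant_conv)

lemma path_im_concat: "path_im (path_concat \<gamma> \<delta>) \<subseteq> path_im \<gamma> \<union> path_im \<delta>"
  by (auto simp: path_im_def path_concat_def)

lemma path_concat_const_right:
  "path_concat \<gamma> (path_const (\<gamma> 1)) = compose {0..1} \<gamma> (\<lambda>t. min 1 (2 * t))"
proof (rule ext)
  fix t :: real
  consider "t \<notin> {0..1}" | "0 \<le> t" "t < 1/2" | "t = 1/2" | "1/2 < t" "t \<le> 1"
    by force
  then show "path_concat \<gamma> (path_const (\<gamma> 1)) t = compose {0..1} \<gamma> (\<lambda>t. min 1 (2 * t)) t"
    by cases (auto simp: path_concat_def compose_def min_def mult.commute[of 2 t])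
qed

text \<open>The bracketing is that of axiom (f). On the left-hand side the path rests until 1/4,
  runs through \<gamma> until 1/2 and then through \<delta>. The clock of
  \<open>path_concat \<gamma> \<delta>\<close> must therefore show 0, then
  \<open>2 * t - 1/2\<close>, then \<open>t\<close>, which is what the maximum and minimum
  express.\<close>

lemma path_concat_const_left:
  "path_concat (path_concat (path_const (\<gamma> 0)) \<gamma>) \<delta> =
    compose {0..1} (path_concat \<gamma> \<delta>) (\<lambda>t. max 0 (min t (2 * t - 1/2)))"
proof (rule ext)
  fix t :: real
  show "path_concat (path_concat (path_const (\<gamma> 0)) \<gamma>) \<delta> t =
    compose {0..1} (path_concat \<gamma> \<delta>) (\<lambda>t. max 0 (min t (2 * t - 1/2))) t"
  proof (cases "t = 1/2")
    case True
    show ?thesis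
      unfolding True by (simp add: path_concat_def compose_def)
  next
    case False
    then consider "t \<notin> {0..1}" | "0 \<le> t" "t \<le> 1/4" | "1/4 < t" "t < 1/2" | "1/2 < t" "t \<le> 1"
      by force
    then show ?thesis
      by cases (auto simp: path_concat_def compose_def max_def min_def algebra_simps)
  qed
qed

context path_triple
begin

lemma Eqv_in_Paths: "(\<gamma>, \<gamma>') \<in> Eqv T \<Longrightarrow> \<gamma> \<in> Paths T \<and> \<gamma>' \<in> Paths T"
  using equiv_type[OF equiv_Eqv] by blast

lemma Eqv_sym: "(\<gamma>, \<gamma>') \<in> Eqv T \<Longrightarrow> (\<gamma>', \<gamma>) \<in> Eqv T"
  using equiv_Eqv by (meson equivE symD)

lemma Eqv_trans: "(\<gamma>, \<gamma>') \<in> Eqv T \<Longrightarrow> (\<gamma>', \<gamma>'') \<in> Eqv T \<Longrightarrow> (\<gamma>, \<gamma>'') \<in> Eqv T"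
  using equiv_Eqv by (meson equivE transD)

lemma Eqv_cong:
  "(\<gamma>, \<delta>) \<in> Eqv T \<Longrightarrow> (\<gamma>', \<delta>') \<in> Eqv T \<Longrightarrow> (\<gamma>, \<gamma>') \<in> Eqv T \<longleftrightarrow> (\<delta>, \<delta>') \<in> Eqv T"
  by (blast intro: Eqv_sym Eqv_trans)

lemma path_point: "\<gamma> \<in> Paths T \<Longrightarrow> t \<in> {0..1} \<Longrightarrow> \<gamma> t \<in> Pts T"
  using Paths_subset by fastforce

lemma path_ends: "\<gamma> \<in> Paths T \<Longrightarrow> \<gamma> 0 \<in> Pts T" "\<gamma> \<in> Paths T \<Longrightarrow> \<gamma> 1 \<in> Pts T"
  by (simp_all add: path_point)

lemma Eqv_concat_const_right:
  "\<gamma> \<in> Paths T \<Longrightarrow> (\<gamma>, path_concat \<gamma> (path_const (\<gamma> 1))) \<in> Eqv T"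
  unfolding path_concat_const_right
  by (rule Eqv_reparam) (auto intro!: path_reparamI mono_onI continuous_intros)

lemma Eqv_concat_const_left:
  "\<lbrakk>\<gamma> \<in> Paths T; \<delta> \<in> Paths T; \<gamma> 1 = \<delta> 0\<rbrakk> \<Longrightarrow>
    (path_concat \<gamma> \<delta>, path_concat (path_concat (path_const (\<gamma> 0)) \<gamma>) \<delta>) \<in> Eqv T"
  unfolding path_concat_const_left
  by (rule Eqv_reparam[OF concat_closed]) (auto intro!: path_reparamI mono_onI continuous_intros)

text \<open>Padding with constant paths turns the two-sided cancellation axiom into one-sided ones.\<close>

lemma Eqv_concat_right_iff:
  assumes "\<gamma> \<in> Paths T" "\<gamma>' \<in> Paths T" "\<delta> \<in> Paths T" "\<gamma> 0 = \<gamma>' 0" "\<gamma> 1 = \<delta> 0" "\<gamma>' 1 = \<delta> 0"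
  shows "(\<gamma>, \<gamma>') \<in> Eqv T \<longleftrightarrow> (path_concat \<gamma> \<delta>, path_concat \<gamma>' \<delta>) \<in> Eqv T"
proof -
  let ?c = "path_const (\<gamma> 0)"
  have "(\<gamma>, \<gamma>') \<in> Eqv T \<longleftrightarrow>
      (path_concat (path_concat ?c \<gamma>) \<delta>, path_concat (path_concat ?c \<gamma>') \<delta>) \<in> Eqv T"
    using assms by (intro Eqv_concat) (simp_all add: const_closed concat_closed path_ends)
  also have "\<dots> \<longleftrightarrow> (path_concat \<gamma> \<delta>, path_concat \<gamma>' \<delta>) \<in> Eqv T"
    by (rule Eqv_cong[OF Eqv_sym Eqv_sym])
      (use Eqv_concat_const_left[of \<gamma> \<delta>] Eqv_concat_const_left[of \<gamma>' \<delta>] assms in simp_all)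
  finally show ?thesis .
qed

lemma Eqv_concat_left_iff:
  assumes "\<delta> \<in> Paths T" "\<delta>' \<in> Paths T" "\<gamma> \<in> Paths T" "\<gamma> 1 = \<delta> 0" "\<gamma> 1 = \<delta>' 0" "\<delta> 1 = \<delta>' 1"
  shows "(\<delta>, \<delta>') \<in> Eqv T \<longleftrightarrow> (path_concat \<gamma> \<delta>, path_concat \<gamma> \<delta>') \<in> Eqv T"
proof -
  let ?c = "path_const (\<delta> 1)"
  have "(\<delta>, \<delta>') \<in> Eqv T \<longleftrightarrow>
      (path_concat (path_concat \<gamma> \<delta>) ?c, path_concat (path_concat \<gamma> \<delta>') ?c) \<in> Eqv T"
    using assms by (intro Eqv_concat) (simp_all add: const_closed concat_closed path_ends)
  also have "\<dots> \<longleftrightarrow> (path_concat \<gamma> \<delta>, path_concat \<gamma> \<delta>') \<in> Eqv T"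
    by (rule Eqv_cong[OF Eqv_sym Eqv_sym])
      (use Eqv_concat_const_right[of "path_concat \<gamma> \<delta>"]
        Eqv_concat_const_right[of "path_concat \<gamma> \<delta>'"] assms in \<open>simp_all add: concat_closed\<close>)
  finally show ?thesis .
qed

text \<open>One factor is replaced at a time, each time by a one-sided equivalence.\<close>

lemma path_precat_congruence: "is_congruence (path_precat T) (Eqv T)"
proof -
  have "(path_concat \<gamma> \<delta>, path_concat \<gamma>' \<delta>') \<in> Eqv T"
    if eqv: "(\<gamma>, \<gamma>') \<in> Eqv T" "(\<delta>, \<delta>') \<in> Eqv T" and "\<gamma> 1 = \<delta> 0" for \<gamma> \<gamma>' \<delta> \<delta>'
  proof (rule Eqv_trans)
    note ends = eqv[THEN Eqv_endpoints] and paths = eqv[THEN Eqv_in_Paths]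
    show "(path_concat \<gamma> \<delta>, path_concat \<gamma>' \<delta>) \<in> Eqv T"
      using Eqv_concat_right_iff[of \<gamma> \<gamma>' \<delta>] that ends paths by simp
    show "(path_concat \<gamma>' \<delta>, path_concat \<gamma>' \<delta>') \<in> Eqv T"
      using Eqv_concat_left_iff[of \<delta> \<delta>' \<gamma>'] that ends paths by simp
  qed
  then show ?thesis
    unfolding is_congruence_def path_precat_def using equiv_Eqv Eqv_endpoints by simp
qed

lemma path_cat_Obj [simp]: "Obj (path_cat T) = Pts T"
  and path_cat_Ide [simp]: "Ide (path_cat T) x = path_class T (path_const x)"
  by (simp_all add: path_cat_def path_precat_def path_class_def)

lemma
  assumes "\<gamma> \<in> Paths T"
  shows path_class_in_Mor [simp]: "path_class T \<gamma> \<in> Mor (path_cat T)"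
    and path_class_Dom [simp]: "Dom (path_cat T) (path_class T \<gamma>) = \<gamma> 0"
    and path_class_Cod [simp]: "Cod (path_cat T) (path_class T \<gamma>) = \<gamma> 1"
  using assms quot_cat_Dom[OF path_precat_congruence, of \<gamma>] quot_cat_Cod[OF path_precat_congruence, of \<gamma>]
  by (simp_all add: path_cat_def path_class_def quotientI) (simp_all add: path_precat_def quotientI)

lemma path_class_Cmp [simp]:
  "\<lbrakk>\<gamma> \<in> Paths T; \<delta> \<in> Paths T; \<gamma> 1 = \<delta> 0\<rbrakk> \<Longrightarrow>
    Cmp (path_cat T) (path_class T \<delta>) (path_class T \<gamma>) = path_class T (path_concat \<gamma> \<delta>)"
  using quot_cat_Cmp[OF path_precat_congruence, of \<gamma> \<delta>]
  by (simp add: path_cat_def path_class_def) (simp add: path_precat_def)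

lemma path_catE:
  assumes "f \<in> Mor (path_cat T)"
  obtains \<gamma> where "\<gamma> \<in> Paths T" "f = path_class T \<gamma>"
  using assms by (auto simp: path_cat_def path_precat_def path_class_def elim: quotientE)

lemma path_class_eq_iff:
  "\<lbrakk>\<gamma> \<in> Paths T; \<gamma>' \<in> Paths T\<rbrakk> \<Longrightarrow> path_class T \<gamma> = path_class T \<gamma>' \<longleftrightarrow> (\<gamma>, \<gamma>') \<in> Eqv T"
  unfolding path_class_def by (rule eq_equiv_class_iff[OF equiv_Eqv])

end

section \<open>Pixelation\<close>

context screen
begin

text \<open>The Ore condition is the dual half of (S3), and the two cancellation laws are the
  one-sided forms of axiom (f).\<close>

lemma pixel_mors_cancellative_ore:
  assumes category: "is_category (path_cat T)"
  shows "cancellative_ore (path_cat T) (pixel_mors T P)"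
proof
  show "is_category (path_cat T)" by (fact category)
  show "pixel_mors T P \<subseteq> Mor (path_cat T)"
    by (auto simp: pixel_mors_def)
  show "Ide (path_cat T) x \<in> pixel_mors T P" if "x \<in> Obj (path_cat T)" for x
    using that partition const_closed unfolding pixel_mors_def in_pixel_def partition_on_def
    by fastforce
next
  fix s t assume "s \<in> pixel_mors T P" "t \<in> pixel_mors T P" and st: "Cod (path_cat T) s = Dom (path_cat T) t"
  then obtain \<rho> \<rho>' X X' where \<rho>: "s = path_class T \<rho>" "\<rho> \<in> Paths T" "X \<in> P" "path_im \<rho> \<subseteq> X"
    and \<rho>': "t = path_class T \<rho>'" "\<rho>' \<in> Paths T" "X' \<in> P" "path_im \<rho>' \<subseteq> X'"
    by (auto simp: pixel_mors_def in_pixel_def)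
  have eq: "\<rho> 1 = \<rho>' 0"
    using st \<rho> \<rho>' by simp
  moreover have "\<rho> 1 \<in> X" "\<rho>' 0 \<in> X'"
    using \<rho> \<rho>' by (auto simp: path_im_def)
  \<comment> \<open>Pixels are disjoint, and the junction point of the two paths lies in
    both.\<close>
  ultimately have "X = X'"
    using disjointD[OF partition_onD2[OF partition] \<rho>(3) \<rho>'(3)] by auto
  then have "in_pixel P (path_concat \<rho> \<rho>')"
    using \<rho> \<rho>' path_im_concat[of \<rho> \<rho>'] unfolding in_pixel_def by blast
  then show "Cmp (path_cat T) t s \<in> pixel_mors T P"
    using \<rho> \<rho>' eq concat_closed unfolding pixel_mors_def by auto
next
  fix s f assume "s \<in> pixel_mors T P" "f \<in> Mor (path_cat T)" and eq: "Cod (path_cat T) s = Cod (path_cat T) f"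
  then obtain \<rho>' \<gamma>' where \<rho>': "s = path_class T \<rho>'" "\<rho>' \<in> Paths T" "in_pixel P \<rho>'"
    and \<gamma>': "f = path_class T \<gamma>'" "\<gamma>' \<in> Paths T"
    by (auto simp: pixel_mors_def elim: path_catE)
  obtain \<rho> \<gamma> where \<rho>: "\<rho> \<in> Paths T" "in_pixel P \<rho>" and \<gamma>: "\<gamma> \<in> Paths T" "\<gamma> 1 = \<rho>' 0" "\<rho> 1 = \<gamma>' 0"
    and eqv: "(path_concat \<gamma> \<rho>', path_concat \<rho> \<gamma>') \<in> Eqv T"
    using pixel_cospan[of \<rho>' \<gamma>'] \<rho>' \<gamma>' eq by auto
  have "\<gamma> 0 = \<rho> 0"
    using Eqv_endpoints[OF eqv] by simp
  moreover have "path_class T \<rho> \<in> pixel_mors T P"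
    using \<rho> by (auto simp: pixel_mors_def)
  ultimately show "\<exists>t\<in>pixel_mors T P. \<exists>g\<in>Mor (path_cat T). Cod (path_cat T) t = Dom (path_cat T) f \<and>
      Cod (path_cat T) g = Dom (path_cat T) s \<and> Dom (path_cat T) g = Dom (path_cat T) t \<and>
      Cmp (path_cat T) s g = Cmp (path_cat T) f t"
    using \<rho> \<gamma> \<rho>' \<gamma>' eqv
    by (intro bexI[of _ "path_class T \<rho>"] bexI[of _ "path_class T \<gamma>"])
      (simp_all add: path_class_eq_iff concat_closed)
next
  fix f g h assume "f \<in> Mor (path_cat T)" "g \<in> Mor (path_cat T)" "h \<in> Mor (path_cat T)"
    and *: "Cod (path_cat T) f = Dom (path_cat T) h" "Cod (path_cat T) g = Dom (path_cat T) h"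
      "Cmp (path_cat T) h f = Cmp (path_cat T) h g"
  then obtain \<gamma> \<gamma>' \<delta> where p: "f = path_class T \<gamma>" "\<gamma> \<in> Paths T" "g = path_class T \<gamma>'" "\<gamma>' \<in> Paths T"
    "h = path_class T \<delta>" "\<delta> \<in> Paths T"
    by (metis path_catE)
  then have eqv: "(path_concat \<gamma> \<delta>, path_concat \<gamma>' \<delta>) \<in> Eqv T"
    using * by (simp add: path_class_eq_iff concat_closed)
  \<comment> \<open>The cancellation law also wants a common start of \<gamma> and \<gamma>'; it is
    read off from the equivalence of the composites.\<close>
  show "f = g"
    using Eqv_concat_right_iff[of \<gamma> \<gamma>' \<delta>] Eqv_endpoints[OF eqv] eqv p * by (simp add: path_class_eq_iff)
next
  fix f g h assume "f \<in> Mor (path_cat T)" "g \<in> Mor (path_cat T)" "h \<in> Mor (path_cat T)"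
    and *: "Cod (path_cat T) h = Dom (path_cat T) f" "Cod (path_cat T) h = Dom (path_cat T) g"
      "Cmp (path_cat T) f h = Cmp (path_cat T) g h"
  then obtain \<gamma> \<gamma>' \<delta> where p: "f = path_class T \<gamma>" "\<gamma> \<in> Paths T" "g = path_class T \<gamma>'" "\<gamma>' \<in> Paths T"
    "h = path_class T \<delta>" "\<delta> \<in> Paths T"
    by (metis path_catE)
  then have eqv: "(path_concat \<delta> \<gamma>, path_concat \<delta> \<gamma>') \<in> Eqv T"
    using * by (simp add: path_class_eq_iff concat_closed)
  show "f = g"
    using Eqv_concat_left_iff[of \<gamma> \<gamma>' \<delta>] Eqv_endpoints[OF eqv] eqv p * by (simp add: path_class_eq_iff)
qed

context
  assumes category: "is_category (path_cat T)"
begin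

interpretation cancellative_ore "path_cat T" "pixel_mors T P"
  by (rule pixel_mors_cancellative_ore[OF category])

text \<open>The relation that is divided out is the kernel of the realization functor, hence a
  congruence. What has to be checked is that this is a functor, that is, that each arrow of the
  quiver realizes to a morphism between the chosen points of its pixels.\<close>

lemma pixelation_category:
  assumes s: "\<forall>X\<in>P. s X \<in> X"
  shows "is_category (pixelation T P s)"
proof -
  have "is_functor (free_cat (pixel_quiver T P s)) (path_loc T P) (pixel_realization T P s)"
    unfolding pixel_realization_def
  proof (rule is_functor_free_functor)
    show "is_category (path_loc T P)"
      unfolding path_loc_def by (rule L_category)
    show "s X \<in> Obj (path_loc T P)" if "X \<in> Vert (pixel_quiver T P s)" for X
      using that s partition unfolding path_loc_def pixel_quiver_def partition_on_def by auto
    show "fst (snd a) \<in> Mor (path_loc T P) \<and>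
        Dom (path_loc T P) (fst (snd a)) = s (Src (pixel_quiver T P s) a) \<and>
        Cod (path_loc T P) (fst (snd a)) = s (Tgt (pixel_quiver T P s) a)"
      if arr: "a \<in> Arr (pixel_quiver T P s)" for a
    proof -
      obtain X Y \<rho> \<gamma> where a: "a = (X, left_fraction T P \<rho> \<gamma>, Y)" "\<rho> \<in> Paths T" "\<gamma> \<in> Paths T"
        "in_pixel P \<rho>" "\<gamma> 0 = s X" "\<gamma> 1 = \<rho> 1" "\<rho> 0 = s Y"
        using arr by (auto simp: pixel_quiver_def pseudo_arrows_def)
      have \<rho>: "path_class T \<rho> \<in> pixel_mors T P"
        using a by (auto simp: pixel_mors_def)
      show ?thesis
        using a loc_inverse[OF \<rho>] Fmo_in_Mor[OF loc_functor, of "path_class T \<gamma>"]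
          Dom_Fmo[OF loc_functor, of "path_class T \<gamma>"] Cod_Fmo[OF loc_functor, of "path_class T \<gamma>"]
        unfolding left_fraction_def path_loc_def path_loc_functor_def pixel_quiver_def
        by (simp add: L_simps del: loc_functor_simps(2))
    qed
  qed
  then show ?thesis
    unfolding pixelation_def pixel_kernel_def
    by (intro is_category_quot_cat is_congruence_functor_kernel is_category_free_cat)
qed

text \<open>Both factors of Hp are faithful and lift spans, and these two properties pass to
  composites.\<close>

lemma pixelation_functor:
  assumes s: "\<forall>X\<in>P. s X \<in> X" and H: "is_pixel_equivalence T P s H"
  shows "is_functor (path_cat T) (pixelation T P s) (pixelation_functor T P H)"
    and "preserves_pullbacks (path_cat T) (pixelation T P s) (pixelation_functor T P H)"
proof -
  note D = pixelation_category[OF s]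
  have H': "is_equivalence L (pixelation T P s) H"
    using H by (simp add: is_pixel_equivalence_def path_loc_def)
  then have HF: "is_functor L (pixelation T P s) H"
    by (simp add: is_equivalence_def)
  have K: "pixelation_functor T P H = comp_functor H (loc_functor (path_cat T) (pixel_mors T P))"
    by (simp add: pixelation_functor_def path_loc_functor_def)
  show "is_functor (path_cat T) (pixelation T P s) (pixelation_functor T P H)"
    unfolding K by (rule is_functor_comp[OF loc_functor HF])
  then show "preserves_pullbacks (path_cat T) (pixelation T P s) (pixelation_functor T P H)"
    unfolding K
    by (intro lifts_spans_preserves_pullbacks[OF category D]
        faithful_comp[OF loc_functor loc_functor_faithful equivalence_faithful[OF L_category D H']]
        lifts_spans_comp[OF L_category D loc_functor HF loc_functor_lifts_spans
          equivalence_lifts_spans[OF L_category D H']])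
qed

end

end

section \<open>Sheaves\<close>

lemma
  assumes "is_presheaf C F"
  shows Res_in_Sec: "\<lbrakk>f \<in> Mor C; a \<in> Sec F (Cod C f)\<rbrakk> \<Longrightarrow> Res F f a \<in> Sec F (Dom C f)"
    and Res_Ide: "\<lbrakk>x \<in> Obj C; a \<in> Sec F x\<rbrakk> \<Longrightarrow> Res F (Ide C x) a = a"
    and Res_Cmp: "\<lbrakk>f \<in> Mor C; g \<in> Mor C; Cod C f = Dom C g; a \<in> Sec F (Cod C g)\<rbrakk> \<Longrightarrow>
      Res F (Cmp C g f) a = Res F f (Res F g a)"
  using assms unfolding is_presheaf_def by blast+

lemma is_sheaf_equalizer:
  assumes sheaf: "is_sheaf C Cov F" and cov: "(x, U) \<in> Cov"
    and pb: "\<forall>f\<in>U. \<forall>g\<in>U. is_pullback C f g (p f g) (q f g)"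
  shows "is_set_equalizer (Sec F x) (\<Pi>\<^sub>E f\<in>U. Sec F (Dom C f))
    (\<Pi>\<^sub>E (f, g)\<in>U \<times> U. Sec F (Dom C (p f g))) (\<lambda>a. \<lambda>f\<in>U. Res F f a)
    (\<lambda>b. \<lambda>(f, g)\<in>U \<times> U. Res F (p f g) (b f)) (\<lambda>b. \<lambda>(f, g)\<in>U \<times> U. Res F (q f g) (b g))"
  using sheaf[unfolded is_sheaf_def, THEN conjunct2, THEN bspec, OF cov, unfolded prod.case,
      THEN conjunct2, THEN spec[of _ p], THEN spec[of _ q], THEN mp, OF pb] .

lemma is_presheaf_precompose:
  assumes C: "is_category C" and K: "is_functor C D K" and F: "is_presheaf D F"
  shows "is_presheaf C (precompose F K)"
proof -
  have "Res F (Fmo K f) a \<in> Sec F (Fob K (Dom C f))" if "f \<in> Mor C" "a \<in> Sec F (Fob K (Cod C f))" for f a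
    using Res_in_Sec[OF F, of "Fmo K f" a] that by (simp add: functor_simps[OF K])
  moreover have "Res F (Fmo K (Ide C x)) a = a" if "x \<in> Obj C" "a \<in> Sec F (Fob K x)" for x a
    using Res_Ide[OF F] that by (simp add: functor_simps[OF K])
  moreover have "Res F (Fmo K (Cmp C g f)) a = Res F (Fmo K f) (Res F (Fmo K g) a)"
    if "f \<in> Mor C" "g \<in> Mor C" "Cod C f = Dom C g" "a \<in> Sec F (Fob K (Cod C g))" for f g a
    using Res_Cmp[OF F, of "Fmo K f" "Fmo K g" a] that by (simp add: functor_simps[OF K] Fmo_Cmp[OF K])
  ultimately show ?thesis
    unfolding is_presheaf_def precompose_def by auto
qed

text \<open>Both sides are the restriction of \<open>a\<close> along the diagonal of the
  square.\<close>

lemma Res_pullback_eq: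
  assumes F: "is_presheaf C F" and pb: "is_pullback C f g p q" and a: "a \<in> Sec F (Cod C f)"
  shows "Res F p (Res F f a) = Res F q (Res F g a)"
proof -
  have *: "f \<in> Mor C" "g \<in> Mor C" "Cod C f = Cod C g" "p \<in> Mor C" "q \<in> Mor C"
      "Cod C p = Dom C f" "Cod C q = Dom C g" "Cmp C f p = Cmp C g q"
    using pb unfolding is_pullback_def by blast+
  show ?thesis
    using Res_Cmp[OF F, of p f a] Res_Cmp[OF F, of q g a] * a by simp
qed

text \<open>Restrict along the diagonal into the pullback of \<open>f\<close> along itself. This takes care of distinct
  members of a covering that have the same image.\<close>

lemma Res_self_pullback_eqD:
  assumes C: "is_category C" and F: "is_presheaf C F" and pb: "is_pullback C f f p q"
    and ab: "a \<in> Sec F (Dom C f)" "b \<in> Sec F (Dom C f)" "Res F p a = Res F q b"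
  shows "a = b"
proof -
  have *: "f \<in> Mor C" "p \<in> Mor C" "q \<in> Mor C" "Dom C p = Dom C q" "Cod C p = Dom C f" "Cod C q = Dom C f"
    using pb unfolding is_pullback_def by blast+
  let ?i = "Ide C (Dom C f)"
  have i: "?i \<in> Mor C" "Dom C ?i = Dom C f" "Cod C ?i = Dom C f" "Dom C f \<in> Obj C"
    using *(1) by (simp_all add: category_simps[OF C])
  obtain d where d: "d \<in> Mor C" "Dom C d = Dom C ?i" "Cod C d = Dom C p" "Cmp C p d = ?i" "Cmp C q d = ?i"
    by (rule pullbackE[OF pb i(1) i(1) HOL.refl i(3) i(3) HOL.refl])
  have "a = Res F d (Res F p a)" "b = Res F d (Res F q b)"
    using Res_Cmp[OF F, of d p a] Res_Cmp[OF F, of d q b] Res_Ide[OF F i(4)] d * ab by simp_all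
  then show ?thesis
    using ab(3) by simp
qed

text \<open>The equalizer for \<open>U\<close> is compared with the one for its image. The latter is
  indexed by a possibly smaller set, so the two products differ, and only on matching families do
  they carry the same information.\<close>

lemma is_sheaf_precompose:
  fixes F :: "('p, 'n, 's) presheaf" and K :: "('o, 'm, 'p, 'n) fun_data"
  assumes C: "is_category C" and D: "is_category D"
    and K: "is_functor C D K" "preserves_pullbacks C D K"
    and cov: "is_coverage C Cov"
    and pullbacks: "\<And>x U f g. \<lbrakk>(x, U) \<in> Cov; f \<in> U; g \<in> U\<rbrakk> \<Longrightarrow> \<exists>p q. is_pullback C f g p q"
    and sheaf: "is_sheaf D (image_coverage K Cov) F"
  shows "is_sheaf C Cov (precompose F K)"
proof -
  have F: "is_presheaf D F"
    using sheaf by (simp add: is_sheaf_def)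
  have "is_set_equalizer (Sec F (Fob K x)) (\<Pi>\<^sub>E f\<in>U. Sec F (Fob K (Dom C f)))
      (\<Pi>\<^sub>E (f, g)\<in>U \<times> U. Sec F (Fob K (Dom C (p f g))))
      (\<lambda>a. \<lambda>f\<in>U. Res F (Fmo K f) a)
      (\<lambda>b. \<lambda>(f, g)\<in>U \<times> U. Res F (Fmo K (p f g)) (b f))
      (\<lambda>b. \<lambda>(f, g)\<in>U \<times> U. Res F (Fmo K (q f g)) (b g))"
    if xU: "(x, U) \<in> Cov" and pq: "\<forall>f\<in>U. \<forall>g\<in>U. is_pullback C f g (p f g) (q f g)" for x U p q
  proof -
    have U: "f \<in> Mor C" "Cod C f = x" if "f \<in> U" for f
      using cov xU that unfolding is_coverage_def by auto
    have KU: "Fmo K f \<in> Mor D" "Dom D (Fmo K f) = Fob K (Dom C f)" "Cod D (Fmo K f) = Fob K x"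
      if "f \<in> U" for f
      using U[OF that] by (simp_all add: functor_simps[OF K(1)])
    have Kpq: "is_pullback D (Fmo K f) (Fmo K g) (Fmo K (p f g)) (Fmo K (q f g))"
      if "f \<in> U" "g \<in> U" for f g
      using K(2) pq that unfolding preserves_pullbacks_def by blast
    have Kp: "Fmo K (p f g) \<in> Mor D" "Dom D (Fmo K (p f g)) = Fob K (Dom C (p f g))"
      "Cod D (Fmo K (p f g)) = Fob K (Dom C f)"
      and Kq: "Fmo K (q f g) \<in> Mor D" "Dom D (Fmo K (q f g)) = Fob K (Dom C (p f g))"
      "Cod D (Fmo K (q f g)) = Fob K (Dom C g)"
      if "f \<in> U" "g \<in> U" for f g
      using pq[rule_format, OF that] unfolding is_pullback_def by (simp_all add: functor_simps[OF K(1)])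
    define V where "V = Fmo K ` U"
    \<comment> \<open>Picks one member of \<open>U\<close> over each element of the image
      covering.\<close>
    define r where "r = inv_into U (Fmo K)"
    have r: "r m \<in> U" "Fmo K (r m) = m" if "m \<in> V" for m
      using that unfolding V_def r_def by (simp_all add: inv_into_into f_inv_into_f)
    let ?e = "\<lambda>a. \<lambda>f\<in>U. Res F (Fmo K f) a" and ?e' = "\<lambda>a. \<lambda>m\<in>V. Res F m a"
    \<comment> \<open>The sheaf condition in \<open>D\<close> holds for every choice of pullbacks,
      so the images of those of the representatives may be chosen.\<close>
    let ?P = "\<lambda>m n. Fmo K (p (r m) (r n))" and ?Q = "\<lambda>m n. Fmo K (q (r m) (r n))"
    let ?u = "\<lambda>b. \<lambda>(f, g)\<in>U \<times> U. Res F (Fmo K (p f g)) (b f)"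
      and ?v = "\<lambda>b. \<lambda>(f, g)\<in>U \<times> U. Res F (Fmo K (q f g)) (b g)"
    let ?B = "\<Pi>\<^sub>E f\<in>U. Sec F (Fob K (Dom C f))"
    have xV: "(Fob K x, V) \<in> image_coverage K Cov"
      using xU unfolding image_coverage_def V_def by blast
    have PQ: "\<forall>m\<in>V. \<forall>n\<in>V. is_pullback D m n (?P m n) (?Q m n)"
      using Kpq r by metis
    have "is_set_equalizer (Sec F (Fob K x)) (\<Pi>\<^sub>E m\<in>V. Sec F (Dom D m))
        (\<Pi>\<^sub>E (m, n)\<in>V \<times> V. Sec F (Dom D (?P m n))) ?e'
        (\<lambda>b. \<lambda>(m, n)\<in>V \<times> V. Res F (?P m n) (b m)) (\<lambda>b. \<lambda>(m, n)\<in>V \<times> V. Res F (?Q m n) (b n))"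
      by (rule is_sheaf_equalizer[OF sheaf xV PQ])
    then have e': "bij_betw ?e' (Sec F (Fob K x)) {b \<in> \<Pi>\<^sub>E m\<in>V. Sec F (Dom D m).
        (\<lambda>(m, n)\<in>V \<times> V. Res F (?P m n) (b m)) = (\<lambda>(m, n)\<in>V \<times> V. Res F (?Q m n) (b n))}"
      unfolding is_set_equalizer_def by blast
    have e: "Res F (Fmo K f) a \<in> Sec F (Fob K (Dom C f))" if "a \<in> Sec F (Fob K x)" "f \<in> U" for a f
      using Res_in_Sec[OF F KU(1)[OF that(2)], of a] that KU by simp
    have u: "Res F (Fmo K (p f g)) (b f) \<in> Sec F (Fob K (Dom C (p f g)))"
      and v: "Res F (Fmo K (q f g)) (b g) \<in> Sec F (Fob K (Dom C (p f g)))"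
      if "b \<in> ?B" "f \<in> U" "g \<in> U" for b f g
      using Res_in_Sec[OF F Kp(1)[OF that(2,3)], of "b f"] Res_in_Sec[OF F Kq(1)[OF that(2,3)], of "b g"]
        PiE_mem[OF that(1,2)] PiE_mem[OF that(1,3)] Kp[OF that(2,3)] Kq[OF that(2,3)] by simp_all
    have inj: "inj_on ?e (Sec F (Fob K x))"
    proof (rule inj_onI)
      fix a a' assume a: "a \<in> Sec F (Fob K x)" "a' \<in> Sec F (Fob K x)" and eq: "?e a = ?e a'"
      have "Res F (Fmo K f) a = Res F (Fmo K f) a'" if "f \<in> U" for f
        using fun_cong[OF eq, of f] that by simp
      then have eq': "?e' a = ?e' a'"
        unfolding V_def by (intro restrict_ext) auto
      show "a = a'"
        by (rule inj_onD[OF bij_betw_imp_inj_on[OF e'] eq' a])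
    qed
    have matching: "?u (?e a) = ?v (?e a)" if "a \<in> Sec F (Fob K x)" for a
      using Res_pullback_eq[OF F Kpq] that KU(3) by (intro restrict_ext) auto
    have surj: "b \<in> ?e ` Sec F (Fob K x)" if b: "b \<in> ?B" and uv: "?u b = ?v b" for b
    proof -
      have eq: "Res F (Fmo K (p f g)) (b f) = Res F (Fmo K (q f g)) (b g)" if "f \<in> U" "g \<in> U" for f g
        using fun_cong[OF uv, of "(f, g)"] that by simp
      \<comment> \<open>The subfamily at the representatives is matching for the image covering, so
        it glues to a section \<open>a\<close>; it remains to recover the other members of
        \<open>b\<close>.\<close>
      define b' where "b' = (\<lambda>m\<in>V. b (r m))"
      have "b' \<in> (\<Pi>\<^sub>E m\<in>V. Sec F (Dom D m))"
        unfolding b'_def using PiE_mem[OF b r(1)] KU(2)[OF r(1)] r(2) by fastforce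
      moreover have "(\<lambda>(m, n)\<in>V \<times> V. Res F (?P m n) (b' m)) = (\<lambda>(m, n)\<in>V \<times> V. Res F (?Q m n) (b' n))"
        unfolding b'_def using eq r(1) by (intro restrict_ext) auto
      ultimately have "b' \<in> ?e' ` Sec F (Fob K x)"
        unfolding bij_betw_imp_surj_on[OF e'] by simp
      then obtain a where a: "a \<in> Sec F (Fob K x)" "?e' a = b'"
        by (auto simp only: image_iff)
      have "b f = Res F (Fmo K f) a" if f: "f \<in> U" for f
      proof -
        let ?m = "Fmo K f"
        have m: "?m \<in> V"
          using f by (simp add: V_def)
        \<comment> \<open>Since \<open>f\<close> and \<open>r ?m\<close> have the same image, the
          image of their pullback is a pullback of \<open>?m\<close> along itself, and matching of
          \<open>b\<close> on this pair is agreement along its two projections.\<close>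
        have "b f = b (r ?m)"
        proof (rule Res_self_pullback_eqD[OF D F])
          show "is_pullback D ?m ?m (Fmo K (p f (r ?m))) (Fmo K (q f (r ?m)))"
            using Kpq[OF f r(1)[OF m]] r(2)[OF m] by simp
          show "b f \<in> Sec F (Dom D ?m)"
            using PiE_mem[OF b f] KU(2)[OF f] by simp
          show "b (r ?m) \<in> Sec F (Dom D ?m)"
            using PiE_mem[OF b r(1)[OF m]] KU(2)[OF r(1)[OF m]] r(2)[OF m] by simp
        qed (rule eq[OF f r(1)[OF m]])
        also have "\<dots> = Res F ?m a"
          using fun_cong[OF a(2), of ?m] m by (simp add: b'_def)
        finally show ?thesis .
      qed
      then have "b = ?e a"
        using b by (intro extensionalityI[of _ U]) (auto simp: PiE_def)
      then show ?thesis
        using a(1) by blast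
    qed
    have "bij_betw ?e (Sec F (Fob K x)) {b \<in> ?B. ?u b = ?v b}"
    proof (rule bij_betw_imageI[OF inj])
      show "?e ` Sec F (Fob K x) = {b \<in> ?B. ?u b = ?v b}"
        using surj matching e by auto
    qed
    then show ?thesis
      unfolding is_set_equalizer_def using e u v by auto
  qed
  then show ?thesis
    using is_presheaf_precompose[OF C K(1) F] pullbacks
    unfolding is_sheaf_def by (auto simp: precompose_def)
qed

text \<open>Site axiom (3), applied to base change along a member of the covering itself.\<close>

lemma is_site_pullbacks:
  assumes "is_site C Cov" "(x, U) \<in> Cov" "f \<in> U" "g \<in> U"
  shows "\<exists>p q. is_pullback C f g p q"
proof -
  have "g \<in> Mor C" "Cod C g = x"
    using assms unfolding is_site_def is_coverage_def by auto
  moreover have "\<forall>x U g. (x, U) \<in> Cov \<and> g \<in> Mor C \<and> Cod C g = x \<longrightarrow>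
      (\<exists>p q. (\<forall>f\<in>U. is_pullback C f g (p f) (q f)) \<and> (Dom C g, q ` U) \<in> Cov)"
    using assms(1) unfolding is_site_def by (elim conjE)
  ultimately obtain p q where "\<forall>f\<in>U. is_pullback C f g (p f) (q f)"
    using assms(2) by blast
  then show ?thesis
    using assms(3) by blast
qed

text \<open>The chosen points \<open>s\<close> and the functor \<open>H\<close> are arbitrary
  subject to their defining properties, so the conclusion holds for every choice of them.\<close>

theorem theorem4p8:
  fixes T :: "'x triple" and P :: "'x set set" and s :: "'x set \<Rightarrow> 'x"
    and H :: "('x, 'x loc_mor, 'x set, 'x pixel_mor) fun_data"
    and Cov :: "('x \<times> 'x path set set) set"
    and F :: "('x set, 'x pixel_mor, 's) presheaf"
  assumes "path_triple T"
    and "is_site (path_cat T) Cov"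
    and "screen T P"
    and "\<forall>X\<in>P. s X \<in> X"
    and "is_pixel_equivalence T P s H"
    and "is_sheaf (pixelation T P s) (image_coverage (pixelation_functor T P H) Cov) F"
  shows "is_sheaf (path_cat T) Cov (precompose F (pixelation_functor T P H))"
proof (rule is_sheaf_precompose)
  show C: "is_category (path_cat T)" and "is_coverage (path_cat T) Cov"
    using assms(2) by (simp_all add: is_site_def)
  show "is_category (pixelation T P s)"
    by (rule screen.pixelation_category[OF assms(3) C assms(4)])
  show "is_functor (path_cat T) (pixelation T P s) (pixelation_functor T P H)"
    "preserves_pullbacks (path_cat T) (pixelation T P s) (pixelation_functor T P H)"
    by (rule screen.pixelation_functor[OF assms(3) C assms(4,5)])+
qed (use is_site_pullbacks[OF assms(2)] assms(6) in blast)+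

end
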